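(* Consider the Lurye system $y_1=Gu_1$, $y_2=\phi u_2$, $u_1=r_1-y_2$, $u_2=y_1+r_2$, assumed well-posed, with $G:\mathcal{L}_{2e}\to\mathcal{L}_{2e}$ linear time-invariant, causal and stable, and $\phi:\mathcal{L}_{2e}\to\mathcal{L}_{2e}$ a (nonlinear) operator. Suppose that: (i) for $y=\phi u$, $y(t)=0$ whenever $u(t)=0$; the nonlinearity of $\phi$ is bounded below by $\underline{\alpha}$ and above by $\overline{\alpha}$, where $\underline{\alpha},\overline{\alpha}:\mathbb{R}\to\mathbb{R}$ are monotone and bounded, and $\underline\alpha(x)/x\ge 0$ for all $x\neq 0$; the nonlinearity is also bounded below by $\underline{\beta}$ and above by $\overline{\beta}$, where $\underline{\beta},\overline{\beta}:\mathbb{R}\to\mathbb{R}$ are monotone, bounded and odd, and $\underline\beta(x)/x\ge 0$ for all $x\neq 0$; (ii) there is a finite $B\ge 1$ such that $\overline{\alpha}$ is bounded above by $B\underline{\alpha}$ and $\overline{\beta}$ is bounded above by $B\underline{\beta}$. Let $H$ be a (not necessarily causal) convolution operator whose impulse response is $h\in\mathbf{H}$ satisfying $$B\|h\|_H<1 .$$ Let $M=1-H$. Then for any $u\in\mathcal{L}_2$, $$\int_{-\infty}^{\infty}(Mu)(t)\,(\phi u)(t)\,dt\ge 0 ,$$ and the Lurye system is stable provided there exists $\varepsilon>0$ such that $\mathrm{Re}\left[M(j\omega)G(j\omega)\right]\ge\varepsilon$ for all $\omega\in\mathbb{R}$.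
   Context: Signals are real-valued measurable functions of $t\in\mathbb{R}$. $\mathcal{L}_2$ is the space of square-integrable signals; $\mathcal{L}_{2e}$ is the extended space of signals all of whose truncations $x_T$ ($x_T(t)=x(t)$ for $t\le T$, $x_T(t)=0$ for $t>T$) lie in $\mathcal{L}_2$. Pointwise conditions on signals are understood for almost all $t$. The Lurye system is well-posed if for all $r_1,r_2\in\mathcal{L}_{2e}$ there are unique $u_1,u_2,y_1,y_2\in\mathcal{L}_{2e}$ satisfying its equations. It is stable if $r_1,r_2\in\mathcal{L}_2$ implies $u_1,u_2,y_1,y_2\in\mathcal{L}_2$. Stability of $G$ means that it maps $\mathcal{L}_2$ boundedly into $\mathcal{L}_2$; $G(j\omega)$ and $M(j\omega)$ denote frequency responses. A function $\alpha:\mathbb{R}\to\mathbb{R}$ is monotone if $\alpha(x_1)\ge\alpha(x_2)$ whenever $x_1\ge x_2$; bounded if there is $C\ge0$ with $|\alpha(x)|\le C|x|$ for all $x$; odd if $\alpha(-x)=-\alpha(x)$ for all $x$. The nonlinearity of $\phi$ (the possibly multivalued relation between $u(t)$ and $y(t)=(\phi u)(t)$) is bounded below by $\underline\alpha$ and above by $\overline\alpha$ if, for all $u\in\mathcal{L}_{2e}$ and $y=\phi u$, $\frac{\underline\alpha(u(t))}{u(t)}\le\frac{y(t)}{u(t)}\le\frac{\overline\alpha(u(t))}{u(t)}$ for all $t$ with $u(t)\ne0$. The operator $\phi$ need not be memoryless or time-invariant. A function $f:\mathbb{R}\to\mathbb{R}$ is bounded above by $g:\mathbb{R}\to\mathbb{R}$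 if $f(x)/x\le g(x)/x$ for all $x\ne0$. $\mathbf{H}$ is the set of generalized functions $h(t)=\sum_i h_i\delta(t-t_i)+h_a(t)$ with $t_i\neq0$, $h_a(0)=0$, $h_i\in\mathbb{R}$, $h_a(t)\in\mathbb{R}$, and $\|h\|_H=\sum_i|h_i|+\int_{-\infty}^{\infty}|h_a(t)|\,dt<\infty$. $M=1-H$ has impulse response $\delta(t)-h(t)$. *)

theory Defs
  imports "HOL-Analysis.Analysis"
begin

section \<open>Signals\<close>

text \<open>
  Signals are Borel functions of time, identified when they agree almost everywhere with respect
  to Lebesgue measure. Every Lebesgue measurable function agrees almost everywhere with a Borel one.
\<close>

type_synonym signal = "real \<Rightarrow> real"

definition ae_eq :: "signal \<Rightarrow> signal \<Rightarrow> bool" where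
  "ae_eq x y \<longleftrightarrow> (AE t in lborel. x t = y t)"

definition trunc :: "real \<Rightarrow> signal \<Rightarrow> signal" where
  "trunc T x = (\<lambda>t. if t \<le> T then x t else 0)"

definition shift :: "real \<Rightarrow> signal \<Rightarrow> signal" where
  "shift \<tau> x = (\<lambda>t. x (t - \<tau>))"

definition L2 :: "signal set" where
  "L2 = {x. x \<in> borel_measurable lborel \<and> integrable lborel (\<lambda>t. (x t)\<^sup>2)}"

definition l2_norm :: "signal \<Rightarrow> real" where
  "l2_norm x = sqrt (LINT t|lborel. (x t)\<^sup>2)"

definition L2e :: "signal set" where
  "L2e = {x. x \<in> borel_measurable lborel \<and> (\<forall>T. trunc T x \<in> L2)}"


section \<open>Operators\<close>

text \<open>The second conjunct makes \<open>A\<close> well defined on almost-everywhere classes.\<close>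

definition L2e_operator :: "(signal \<Rightarrow> signal) \<Rightarrow> bool" where
  "L2e_operator A \<longleftrightarrow>
     (\<forall>u\<in>L2e. A u \<in> L2e) \<and> (\<forall>u\<in>L2e. \<forall>v\<in>L2e. ae_eq u v \<longrightarrow> ae_eq (A u) (A v))"

definition linear_operator :: "(signal \<Rightarrow> signal) \<Rightarrow> bool" where
  "linear_operator A \<longleftrightarrow>
     (\<forall>u\<in>L2e. \<forall>v\<in>L2e. \<forall>a b. ae_eq (A (\<lambda>t. a * u t + b * v t)) (\<lambda>t. a * A u t + b * A v t))"

definition time_invariant :: "(signal \<Rightarrow> signal) \<Rightarrow> bool" where
  "time_invariant A \<longleftrightarrow> (\<forall>u\<in>L2e. \<forall>\<tau>. ae_eq (A (shift \<tau> u)) (shift \<tau> (A u)))"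

definition causal :: "(signal \<Rightarrow> signal) \<Rightarrow> bool" where
  "causal A \<longleftrightarrow> (\<forall>u\<in>L2e. \<forall>T. ae_eq (trunc T (A u)) (trunc T (A (trunc T u))))"

definition stable_operator :: "(signal \<Rightarrow> signal) \<Rightarrow> bool" where
  "stable_operator A \<longleftrightarrow>
     (\<exists>C\<ge>0. \<forall>u\<in>L2. A u \<in> L2 \<and> l2_norm (A u) \<le> C * l2_norm u)"


section \<open>Frequency responses\<close>

text \<open>
  \<open>X\<close> is the Fourier (Plancherel) transform of the square-integrable signal \<open>x\<close>: the mean-square
  limit of the transforms of \<open>x\<close> restricted to \<open>{-T..T}\<close>.
\<close>

definition fourier_transform :: "signal \<Rightarrow> (real \<Rightarrow> complex) \<Rightarrow> bool" where
  "fourier_transform x X \<longleftrightarrow>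
     X \<in> borel_measurable lborel \<and> integrable lborel (\<lambda>\<omega>. (cmod (X \<omega>))\<^sup>2) \<and>
     ((\<lambda>T. \<integral>\<^sup>+ \<omega>. ennreal ((cmod (X \<omega> -
        (LINT t:{-T..T}|lborel. complex_of_real (x t) * cis (- (\<omega> * t)))))\<^sup>2) \<partial>lborel)
      \<longlongrightarrow> 0) at_top"

text \<open>
  The frequency response \<open>\<omega> \<mapsto> A(j\<omega>)\<close> of a stable linear time-invariant operator is
  determined up to a null set, hence the relational form.
\<close>

definition frequency_response :: "(signal \<Rightarrow> signal) \<Rightarrow> (real \<Rightarrow> complex) \<Rightarrow> bool" where
  "frequency_response A Ahat \<longleftrightarrow>
     Ahat \<in> borel_measurable lborel \<and>
     (\<forall>u\<in>L2. \<forall>U. fourier_transform u U \<longrightarrow> fourier_transform (A u) (\<lambda>\<omega>. Ahat \<omega> * U \<omega>))"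


section \<open>Multipliers\<close>

text \<open>
  The generalized function \<open>\<Sum>i. weight h i * \<delta>(t - loc h i) + dens h t\<close>. A finite sum of
  impulses is represented by zero weights at further locations.
\<close>

datatype gfun = Gfun (weight: "nat \<Rightarrow> real") (loc: "nat \<Rightarrow> real") (dens: "real \<Rightarrow> real")

definition HH :: "gfun set" where
  "HH = {h. inj (loc h) \<and> (\<forall>i. loc h i \<noteq> 0) \<and> dens h 0 = 0 \<and>
            summable (\<lambda>i. \<bar>weight h i\<bar>) \<and> integrable lborel (dens h)}"

definition H_norm :: "gfun \<Rightarrow> real" where
  "H_norm h = (\<Sum>i. \<bar>weight h i\<bar>) + (LINT t|lborel. \<bar>dens h t\<bar>)"

definition conv_op :: "gfun \<Rightarrow> signal \<Rightarrow> signal" where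
  "conv_op h u = (\<lambda>t. (\<Sum>i. weight h i * u (t - loc h i)) + (LINT \<tau>|lborel. dens h \<tau> * u (t - \<tau>)))"

definition multiplier :: "gfun \<Rightarrow> signal \<Rightarrow> signal" where
  "multiplier h u = (\<lambda>t. u t - conv_op h u t)"

definition multiplier_freq :: "gfun \<Rightarrow> real \<Rightarrow> complex" where
  "multiplier_freq h \<omega> = 1 -
     ((\<Sum>i. complex_of_real (weight h i) * cis (- (\<omega> * loc h i))) +
      (LINT t|lborel. complex_of_real (dens h t) * cis (- (\<omega> * t))))"


section \<open>Nonlinearities\<close>

definition bounded_fun :: "(real \<Rightarrow> real) \<Rightarrow> bool" where
  "bounded_fun \<alpha> \<longleftrightarrow> (\<exists>C\<ge>0. \<forall>x. \<bar>\<alpha> x\<bar> \<le> C * \<bar>x\<bar>)"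

definition odd_fun :: "(real \<Rightarrow> real) \<Rightarrow> bool" where
  "odd_fun \<alpha> \<longleftrightarrow> (\<forall>x. \<alpha> (- x) = - \<alpha> x)"

definition bounded_above_by :: "(real \<Rightarrow> real) \<Rightarrow> (real \<Rightarrow> real) \<Rightarrow> bool" where
  "bounded_above_by f g \<longleftrightarrow> (\<forall>x. x \<noteq> 0 \<longrightarrow> f x / x \<le> g x / x)"

definition nonlinearity_bounded ::
    "(signal \<Rightarrow> signal) \<Rightarrow> (real \<Rightarrow> real) \<Rightarrow> (real \<Rightarrow> real) \<Rightarrow> bool" where
  "nonlinearity_bounded \<phi> lo hi \<longleftrightarrow>
     (\<forall>u\<in>L2e. AE t in lborel. u t \<noteq> 0 \<longrightarrow>
        lo (u t) / u t \<le> \<phi> u t / u t \<and> \<phi> u t / u t \<le> hi (u t) / u t)"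


section \<open>The Lurye system\<close>

definition lurye ::
    "(signal \<Rightarrow> signal) \<Rightarrow> (signal \<Rightarrow> signal) \<Rightarrow> signal \<Rightarrow> signal \<Rightarrow>
     signal \<Rightarrow> signal \<Rightarrow> signal \<Rightarrow> signal \<Rightarrow> bool" where
  "lurye G \<phi> r1 r2 u1 u2 y1 y2 \<longleftrightarrow>
     u1 \<in> L2e \<and> u2 \<in> L2e \<and> y1 \<in> L2e \<and> y2 \<in> L2e \<and>
     ae_eq y1 (G u1) \<and> ae_eq y2 (\<phi> u2) \<and>
     ae_eq u1 (\<lambda>t. r1 t - y2 t) \<and> ae_eq u2 (\<lambda>t. y1 t + r2 t)"

definition lurye_well_posed :: "(signal \<Rightarrow> signal) \<Rightarrow> (signal \<Rightarrow> signal) \<Rightarrow> bool" where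
  "lurye_well_posed G \<phi> \<longleftrightarrow>
     (\<forall>r1\<in>L2e. \<forall>r2\<in>L2e.
        (\<exists>u1 u2 y1 y2. lurye G \<phi> r1 r2 u1 u2 y1 y2) \<and>
        (\<forall>u1 u2 y1 y2 v1 v2 z1 z2.
           lurye G \<phi> r1 r2 u1 u2 y1 y2 \<and> lurye G \<phi> r1 r2 v1 v2 z1 z2 \<longrightarrow>
           ae_eq u1 v1 \<and> ae_eq u2 v2 \<and> ae_eq y1 z1 \<and> ae_eq y2 z2))"

definition lurye_stable :: "(signal \<Rightarrow> signal) \<Rightarrow> (signal \<Rightarrow> signal) \<Rightarrow> bool" where
  "lurye_stable G \<phi> \<longleftrightarrow>
     (\<forall>r1\<in>L2. \<forall>r2\<in>L2. \<forall>u1 u2 y1 y2.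
        lurye G \<phi> r1 r2 u1 u2 y1 y2 \<longrightarrow> u1 \<in> L2 \<and> u2 \<in> L2 \<and> y1 \<in> L2 \<and> y2 \<in> L2)"

end

theory Submission
  imports Defs "HOL-Probability.Probability"
begin

text \<open>
  Positivity. For \<open>\<beta>\<close> monotone with \<open>\<beta> 0 = 0\<close> and \<open>f \<ge> 0\<close> the rearrangement inequality
  \<open>\<integral>f(t - \<tau>) \<beta>(f t) dt \<le> \<integral>f(t) \<beta>(f t) dt\<close> holds: \<open>\<beta>\<close> is a subgradient of its primitive.
  With \<open>f = \<bar>u\<bar>\<close> and the sector condition \<open>\<beta> \<bar>u\<bar> \<le> \<bar>y\<bar> \<le> B \<beta> \<bar>u\<bar>\<close> this bounds
  every \<open>\<bar>\<integral>u(t - \<tau>) y(t) dt\<bar>\<close> by \<open>B \<integral>u y\<close>, so the convolution part of \<open>M\<close> is dominated by the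
  identity as soon as \<open>B \<parallel>h\<parallel> \<le> 1\<close>.

  Stability. No factorization of the noncausal multiplier and no homotopy is needed. Fix \<open>T\<close> and let
  \<open>u\<close>, \<open>y\<close> be the input and output of \<open>\<phi>\<close> in the loop. Since \<open>\<parallel>h\<parallel> < 1\<close>, Neumann iteration on
  \<open>(T, \<infinity>)\<close> continues \<open>u\<close> and \<open>y\<close> beyond \<open>T\<close> to square-integrable signals \<open>a\<close> and \<open>b\<close> such that
  \<open>M a\<close> and \<open>M\<^sup>* b\<close> vanish after \<open>T\<close>, up to an arbitrarily small error. The sector relation is pointwise,
  so \<open>y\<close> followed by \<open>\<beta> a\<close> is an admissible output for \<open>a\<close>, and up to that error
  \<open>0 \<le> \<langle>M a, y\<rangle> = \<langle>M a, b\<rangle> = \<langle>a, M\<^sup>* b\<rangle> = \<langle>u, M\<^sup>* b\<rangle> = \<langle>g - G b, M\<^sup>* b\<rangle> \<le> \<parallel>M g\<parallel> \<parallel>b\<parallel> - \<epsilon> \<parallel>b\<parallel>\<^sup>2\<close>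
  with \<open>g = r\<^sub>2 + G r\<^sub>1\<close>. This bounds the truncations of \<open>y\<close> uniformly in \<open>T\<close>. The frequency condition
  enters through \<open>\<langle>M G b, b\<rangle> \<ge> \<epsilon> \<parallel>b\<parallel>\<^sup>2\<close>, which needs Plancherel's theorem only for a dense class of \<open>b\<close>.
\<close>

section \<open>Square-integrable signals\<close>

definition ip :: "signal \<Rightarrow> signal \<Rightarrow> real" where
  "ip x y = (LINT t|lborel. x t * y t)"

definition tail :: "real \<Rightarrow> signal \<Rightarrow> signal" where
  "tail T x = (\<lambda>t. if T < t then x t else 0)"

lemma L2_measurable: "x \<in> L2 \<Longrightarrow> x \<in> borel_measurable borel"
  by (simp add: L2_def)

lemma L2_square: "x \<in> L2 \<Longrightarrow> integrable lborel (\<lambda>t. (x t)\<^sup>2)"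
  by (simp add: L2_def)

lemma L2I: "x \<in> borel_measurable borel \<Longrightarrow> integrable lborel (\<lambda>t. (x t)\<^sup>2) \<Longrightarrow> x \<in> L2"
  by (simp add: L2_def)

lemma L2_integrable_mult:
  assumes "x \<in> L2" "y \<in> L2"
  shows "integrable lborel (\<lambda>t. x t * y t)"
proof (rule Bochner_Integration.integrable_bound)
  show "integrable lborel (\<lambda>t. (x t)\<^sup>2 + (y t)\<^sup>2)"
    using assms by (intro Bochner_Integration.integrable_add L2_square)
  show "(\<lambda>t. x t * y t) \<in> borel_measurable lborel"
    using assms[THEN L2_measurable] by simp
  show "AE t in lborel. norm (x t * y t) \<le> norm ((x t)\<^sup>2 + (y t)\<^sup>2)"
  proof (rule AE_I2)
    fix t
    have "2 * (\<bar>x t\<bar> * \<bar>y t\<bar>) \<le> (x t)\<^sup>2 + (y t)\<^sup>2"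
      using sum_squares_bound[of "\<bar>x t\<bar>" "\<bar>y t\<bar>"] by simp
    moreover have "0 \<le> \<bar>x t\<bar> * \<bar>y t\<bar>" by simp
    ultimately have "\<bar>x t\<bar> * \<bar>y t\<bar> \<le> (x t)\<^sup>2 + (y t)\<^sup>2" by linarith
    then show "norm (x t * y t) \<le> norm ((x t)\<^sup>2 + (y t)\<^sup>2)"
      by (simp add: abs_mult)
  qed
qed

lemma L2_dominated:
  assumes "x \<in> L2" and [measurable]: "y \<in> borel_measurable borel"
    and le: "AE t in lborel. \<bar>y t\<bar> \<le> C * \<bar>x t\<bar>"
  shows "y \<in> L2"
proof (rule L2I)
  have [measurable]: "x \<in> borel_measurable borel" by (rule L2_measurable[OF assms(1)])
  show "integrable lborel (\<lambda>t. (y t)\<^sup>2)"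
  proof (rule Bochner_Integration.integrable_bound)
    show "integrable lborel (\<lambda>t. C\<^sup>2 * (x t)\<^sup>2)"
      using L2_square[OF assms(1)] by simp
    show "AE t in lborel. norm ((y t)\<^sup>2) \<le> norm (C\<^sup>2 * (x t)\<^sup>2)"
      using le
    proof eventually_elim
      case (elim t)
      then have "\<bar>y t\<bar>\<^sup>2 \<le> (C * \<bar>x t\<bar>)\<^sup>2" by (intro power_mono) auto
      then show ?case by (simp add: power_mult_distrib)
    qed
  qed simp
qed fact

lemma L2_lin:
  assumes "x \<in> L2" "y \<in> L2"
  shows "(\<lambda>t. a * x t + b * y t) \<in> L2"
proof (rule L2I)
  have "(\<lambda>t. (a * x t + b * y t)\<^sup>2) =
      (\<lambda>t. a\<^sup>2 * (x t)\<^sup>2 + b\<^sup>2 * (y t)\<^sup>2 + 2 * a * b * (x t * y t))"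
    by (auto simp: power2_eq_square algebra_simps)
  moreover have "integrable lborel \<dots>"
    using assms[THEN L2_square] L2_integrable_mult[OF assms] by simp
  ultimately show "integrable lborel (\<lambda>t. (a * x t + b * y t)\<^sup>2)" by simp
qed (use assms[THEN L2_measurable] in simp)

lemma L2_add: "x \<in> L2 \<Longrightarrow> y \<in> L2 \<Longrightarrow> (\<lambda>t. x t + y t) \<in> L2"
  using L2_lin[of x y 1 1] by simp

lemma L2_diff: "x \<in> L2 \<Longrightarrow> y \<in> L2 \<Longrightarrow> (\<lambda>t. x t - y t) \<in> L2"
  using L2_lin[of x y 1 "-1"] by simp

lemma L2_scale: "x \<in> L2 \<Longrightarrow> (\<lambda>t. a * x t) \<in> L2"
  using L2_lin[of x x a 0] by simp

lemma L2_abs: "x \<in> L2 \<Longrightarrow> (\<lambda>t. \<bar>x t\<bar>) \<in> L2"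
  by (rule L2_dominated[of x _ 1]) (auto dest: L2_measurable)

lemma trunc_measurable [measurable]:
  "x \<in> borel_measurable borel \<Longrightarrow> trunc T x \<in> borel_measurable borel"
  unfolding trunc_def by simp

lemma L2_trunc: "x \<in> L2 \<Longrightarrow> trunc T x \<in> L2"
  by (rule L2_dominated[of x _ 1]) (auto dest: L2_measurable simp: trunc_def[abs_def])

lemma L2_tail: "x \<in> L2 \<Longrightarrow> tail T x \<in> L2"
  by (rule L2_dominated[of x _ 1]) (auto dest: L2_measurable simp: tail_def[abs_def])

lemma L2_shift:
  assumes "x \<in> L2"
  shows "(\<lambda>t. x (t - \<tau>)) \<in> L2"
proof (rule L2I)
  show "integrable lborel (\<lambda>t. (x (t - \<tau>))\<^sup>2)"
    using lborel_integrable_real_affine[OF L2_square[OF assms], of 1 "-\<tau>"]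
    by (simp add: add.commute)
qed (use L2_measurable[OF assms] in simp)

lemma L2_subset_L2e: "x \<in> L2 \<Longrightarrow> x \<in> L2e"
  by (auto simp: L2e_def L2_trunc L2_measurable)

lemma L2e_measurable: "x \<in> L2e \<Longrightarrow> x \<in> borel_measurable borel"
  by (simp add: L2e_def)

lemma L2e_diff:
  assumes "x \<in> L2e" "y \<in> L2e"
  shows "(\<lambda>t. x t - y t) \<in> L2e"
proof -
  have "trunc T (\<lambda>t. x t - y t) = (\<lambda>t. trunc T x t - trunc T y t)" for T
    by (auto simp: trunc_def)
  with assms show ?thesis
    by (auto simp: L2e_def L2_diff)
qed

lemma L2_cong_AE:
  "x \<in> L2 \<Longrightarrow> y \<in> borel_measurable borel \<Longrightarrow> ae_eq x y \<Longrightarrow> y \<in> L2"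
  by (rule L2_dominated[of x _ 1]) (auto simp: ae_eq_def)

section \<open>Inner product and norm on square-integrable signals\<close>

lemma ip_self: "ip x x = (l2_norm x)\<^sup>2"
  by (simp add: ip_def l2_norm_def power2_eq_square)

lemma l2_norm_nonneg [simp]: "0 \<le> l2_norm x"
  by (simp add: l2_norm_def)

lemma ip_commute: "ip x y = ip y x"
  by (simp add: ip_def mult.commute)

lemma ip_add_left:
  "x \<in> L2 \<Longrightarrow> y \<in> L2 \<Longrightarrow> z \<in> L2 \<Longrightarrow> ip (\<lambda>t. x t + y t) z = ip x z + ip y z"
  by (simp add: ip_def distrib_right L2_integrable_mult)

lemma ip_diff_left:
  "x \<in> L2 \<Longrightarrow> y \<in> L2 \<Longrightarrow> z \<in> L2 \<Longrightarrow> ip (\<lambda>t. x t - y t) z = ip x z - ip y z"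
  by (simp add: ip_def left_diff_distrib L2_integrable_mult)

lemma ip_add_right:
  "x \<in> L2 \<Longrightarrow> y \<in> L2 \<Longrightarrow> z \<in> L2 \<Longrightarrow> ip z (\<lambda>t. x t + y t) = ip z x + ip z y"
  by (simp add: ip_def distrib_left L2_integrable_mult)

lemma ip_diff_right:
  "x \<in> L2 \<Longrightarrow> y \<in> L2 \<Longrightarrow> z \<in> L2 \<Longrightarrow> ip z (\<lambda>t. x t - y t) = ip z x - ip z y"
  by (simp add: ip_def right_diff_distrib L2_integrable_mult)

lemma ip_scale_left: "ip (\<lambda>t. a * x t) z = a * ip x z"
  by (simp add: ip_def mult.assoc)

lemma ip_cong_AE:
  assumes "ae_eq x x'" "ae_eq y y'"
    and [measurable]: "x \<in> borel_measurable borel" "x' \<in> borel_measurable borel"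
      "y \<in> borel_measurable borel" "y' \<in> borel_measurable borel"
  shows "ip x y = ip x' y'"
  unfolding ip_def
proof (rule integral_cong_AE)
  show "AE t in lborel. x t * y t = x' t * y' t"
    using assms(1,2) unfolding ae_eq_def by eventually_elim simp
qed simp_all

text \<open>Cauchy-Schwarz: the squared norm of \<open>\<bar>x\<bar> - s * \<bar>y\<bar>\<close> is
  a quadratic in \<open>s\<close> that never becomes negative. The absolute values are kept because
  the absolute integrability check behind \<open>ip_op\<close> needs this stronger form.\<close>

lemma ip_abs_le_norm:
  assumes "x \<in> L2" "y \<in> L2"
  shows "ip (\<lambda>t. \<bar>x t\<bar>) (\<lambda>t. \<bar>y t\<bar>) \<le> l2_norm x * l2_norm y"
proof -
  let ?x = "\<lambda>t. \<bar>x t\<bar>" and ?y = "\<lambda>t. \<bar>y t\<bar>"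
  note L = assms[THEN L2_abs]
  have nx: "l2_norm ?x = l2_norm x" "l2_norm ?y = l2_norm y" by (simp_all add: l2_norm_def)
  have pos: "0 \<le> (l2_norm x)\<^sup>2 - 2 * s * ip ?x ?y + s\<^sup>2 * (l2_norm y)\<^sup>2" for s
  proof -
    let ?z = "\<lambda>t. ?x t - s * ?y t"
    have z: "?z \<in> L2" using L2_lin[OF L, of 1 "-s"] by simp
    have "0 \<le> ip ?z ?z" unfolding ip_self by simp
    also have "ip ?z ?z = ip ?x ?z - s * ip ?y ?z"
      using L z L2_scale[OF L(2), of s] by (simp add: ip_diff_left ip_scale_left)
    also have "ip ?x ?z = ip ?x ?x - s * ip ?y ?x"
      unfolding ip_commute[of ?x ?z] using L L2_scale[OF L(2), of s] by (simp add: ip_diff_left ip_scale_left)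
    also have "ip ?y ?z = ip ?x ?y - s * ip ?y ?y"
      unfolding ip_commute[of ?y ?z] using L L2_scale[OF L(2), of s] by (simp add: ip_diff_left ip_scale_left)
    finally show ?thesis unfolding ip_self nx ip_commute[of ?y ?x]
      by (simp add: algebra_simps power2_eq_square)
  qed
  have "(ip ?x ?y)\<^sup>2 \<le> (l2_norm x)\<^sup>2 * (l2_norm y)\<^sup>2"
  proof (cases "l2_norm y = 0")
    case True
    have "ip ?x ?y = 0"
    proof (rule ccontr)
      assume ne: "ip ?x ?y \<noteq> 0"
      \<comment> \<open>With a vanishing leading coefficient the quadratic is affine in
        \<open>s\<close>; this \<open>s\<close> would push it below zero.\<close>
      have "0 \<le> (l2_norm x)\<^sup>2 - 2 * (((l2_norm x)\<^sup>2 + 1) / ip ?x ?y) * ip ?x ?y"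
        using pos[of "((l2_norm x)\<^sup>2 + 1) / ip ?x ?y"] True by simp
      also have "\<dots> = - (l2_norm x)\<^sup>2 - 2" using ne by simp
      finally have "0 \<le> - (l2_norm x)\<^sup>2 - 2" .
      moreover have "0 \<le> (l2_norm x)\<^sup>2" by simp
      ultimately show False by linarith
    qed
    then show ?thesis by simp
  next
    case False
    then have p: "(l2_norm y)\<^sup>2 > 0" by simp
    \<comment> \<open>The quadratic at its minimizer, multiplied by the square of the norm of
      \<open>y\<close> to clear denominators.\<close>
    have "0 \<le> ((l2_norm x)\<^sup>2 - 2 * (ip ?x ?y / (l2_norm y)\<^sup>2) * ip ?x ?y
        + (ip ?x ?y / (l2_norm y)\<^sup>2)\<^sup>2 * (l2_norm y)\<^sup>2) * (l2_norm y)\<^sup>2"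
      using pos[of "ip ?x ?y / (l2_norm y)\<^sup>2"] p by (intro mult_nonneg_nonneg) auto
    also have "\<dots> = (l2_norm x)\<^sup>2 * (l2_norm y)\<^sup>2 - (ip ?x ?y)\<^sup>2"
      using False by (simp add: field_simps power2_eq_square)
    finally show ?thesis by simp
  qed
  then have "(ip ?x ?y)\<^sup>2 \<le> (l2_norm x * l2_norm y)\<^sup>2" by (simp add: power_mult_distrib)
  then show ?thesis by (rule power2_le_imp_le) simp
qed

lemma ip_le_norm:
  assumes "x \<in> L2" "y \<in> L2"
  shows "\<bar>ip x y\<bar> \<le> l2_norm x * l2_norm y"
proof -
  have "\<bar>ip x y\<bar> \<le> ip (\<lambda>t. \<bar>x t\<bar>) (\<lambda>t. \<bar>y t\<bar>)"
    unfolding ip_def abs_mult[symmetric] by (rule integral_abs_bound)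
  also note ip_abs_le_norm[OF assms]
  finally show ?thesis .
qed

lemma l2_norm_add_le:
  assumes "x \<in> L2" "y \<in> L2"
  shows "l2_norm (\<lambda>t. x t + y t) \<le> l2_norm x + l2_norm y"
proof (rule power2_le_imp_le)
  have "(l2_norm (\<lambda>t. x t + y t))\<^sup>2 = (l2_norm x)\<^sup>2 + 2 * ip x y + (l2_norm y)\<^sup>2"
    using assms L2_add[OF assms]
    by (simp add: ip_self[symmetric] ip_add_left ip_add_right ip_commute[of y x])
  also have "\<dots> \<le> (l2_norm x + l2_norm y)\<^sup>2"
    using ip_le_norm[OF assms] by (simp add: power2_sum)
  finally show "(l2_norm (\<lambda>t. x t + y t))\<^sup>2 \<le> (l2_norm x + l2_norm y)\<^sup>2" .
qed simp

lemma l2_norm_minus_commute: "l2_norm (\<lambda>t. y t - x t) = l2_norm (\<lambda>t. x t - y t)"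
  by (simp add: l2_norm_def power2_commute)

lemma l2_norm_diff_le:
  assumes "x \<in> L2" "y \<in> L2"
  shows "l2_norm (\<lambda>t. x t - y t) \<le> l2_norm x + l2_norm y"
proof -
  have "l2_norm (\<lambda>t. - 1 * y t) = l2_norm y" by (simp add: l2_norm_def)
  then show ?thesis using l2_norm_add_le[OF assms(1) L2_scale[OF assms(2), of "-1"]] by simp
qed

lemma l2_norm_mono:
  assumes "x \<in> L2" "y \<in> borel_measurable borel" "AE t in lborel. \<bar>y t\<bar> \<le> \<bar>x t\<bar>"
  shows "l2_norm y \<le> l2_norm x"
proof -
  have "y \<in> L2" using assms by (intro L2_dominated[of x y 1]) auto
  then show ?thesis unfolding l2_norm_def
    using assms by (intro real_sqrt_le_mono integral_mono_AE)
      (auto intro: L2_square simp: abs_le_square_iff)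
qed

lemma l2_norm_scale: "l2_norm (\<lambda>t. a * x t) = \<bar>a\<bar> * l2_norm x"
  by (simp add: l2_norm_def power_mult_distrib real_sqrt_mult)

lemma l2_norm_trunc: "x \<in> L2 \<Longrightarrow> l2_norm (trunc T x) \<le> l2_norm x"
  by (rule l2_norm_mono) (auto dest: L2_measurable simp: trunc_def[abs_def])

lemma l2_norm_tail: "x \<in> L2 \<Longrightarrow> l2_norm (tail T x) \<le> l2_norm x"
  by (rule l2_norm_mono) (auto dest: L2_measurable simp: tail_def[abs_def])

lemma l2_norm_shift: "l2_norm (\<lambda>t. x (t - \<tau>)) = l2_norm x"
  unfolding l2_norm_def
  using lborel_integral_real_affine[of 1 "\<lambda>t. (x t)\<^sup>2" "-\<tau>"] by (simp add: add.commute)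

lemma l2_norm_cong_AE:
  assumes "ae_eq x y" "x \<in> borel_measurable borel" "y \<in> borel_measurable borel"
  shows "l2_norm x = l2_norm y"
  using ip_cong_AE[OF assms(1,1,2,3,2,3)] l2_norm_nonneg
  by (metis ip_self power2_eq_iff_nonneg)

lemma l2_norm_zero_AE:
  assumes "x \<in> L2" "l2_norm x = 0"
  shows "AE t in lborel. x t = 0"
proof -
  have "(LINT t|lborel. (x t)\<^sup>2) = 0"
    using assms(2) by (simp add: l2_norm_def)
  then have "AE t in lborel. (x t)\<^sup>2 = 0"
    using integral_nonneg_eq_0_iff_AE[OF L2_square[OF assms(1)]] by simp
  then show ?thesis by simp
qed

text \<open>Together with \<open>ip_tail\<close>: the two complementary projections are
  self-adjoint, which lets knowledge about one signal before or after \<open>T\<close> act on the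
  other factor of a pairing.\<close>

lemma ip_trunc: "ip (trunc T x) y = ip x (trunc T y)"
  unfolding ip_def trunc_def by (rule Bochner_Integration.integral_cong) auto

lemma ip_tail: "ip (tail T x) y = ip x (tail T y)"
  unfolding ip_def tail_def by (rule Bochner_Integration.integral_cong) auto

lemma trunc_plus_tail: "(\<lambda>t. trunc T x t + tail T x t) = x"
  by (auto simp: trunc_def tail_def)

lemma ip_split:
  assumes "x \<in> L2" "y \<in> L2"
  shows "ip x y = ip (trunc T x) y + ip (tail T x) y"
  using ip_add_left[OF L2_trunc[OF assms(1), of T] L2_tail[OF assms(1), of T] assms(2)]
  unfolding trunc_plus_tail .

section \<open>Superpositions of delays\<close>

text \<open>Cross-correlation at lag \<open>\<tau>\<close>. Pairing a superposition of delays with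
  \<open>y\<close> averages this function over the lags, so a bound uniform in the lag becomes a
  bound on the convolution.\<close>

definition corr :: "signal \<Rightarrow> signal \<Rightarrow> real \<Rightarrow> real" where
  "corr u y \<tau> = (LINT t|lborel. u (t - \<tau>) * y t)"

lemma corr_0: "corr u y 0 = ip u y"
  by (simp add: corr_def ip_def)

lemma corr_reflect: "corr u y (- \<tau>) = corr y u \<tau>"
  unfolding corr_def
  using lborel_integral_real_affine[of 1 "\<lambda>t. u (t + \<tau>) * y t" "-\<tau>"]
  by (simp add: mult.commute add.commute)

lemma corr_le_norm:
  assumes "u \<in> L2" "y \<in> L2"
  shows "\<bar>corr u y \<tau>\<bar> \<le> l2_norm u * l2_norm y"
  using ip_le_norm[OF L2_shift[OF assms(1), of \<tau>] assms(2)]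
  by (simp add: corr_def ip_def l2_norm_shift)

lemma corr_lin_left:
  assumes "u \<in> L2" "v \<in> L2" "y \<in> L2"
  shows "corr (\<lambda>t. u t - v t) y \<tau> = corr u y \<tau> - corr v y \<tau>"
  using ip_diff_left[OF L2_shift[OF assms(1), of \<tau>] L2_shift[OF assms(2), of \<tau>] assms(3)]
  by (simp add: corr_def ip_def)

text \<open>A superposition of delays over an arbitrary index space: sums of impulses and
  convolutions with densities are the two instances.\<close>

locale delays = sigma_finite_measure K for K :: "'a measure" +
  fixes k :: "'a \<Rightarrow> real" and l :: "'a \<Rightarrow> real"
  assumes k: "integrable K k" and l [measurable]: "l \<in> borel_measurable K"
begin

lemma k_measurable [measurable]: "k \<in> borel_measurable K"
  using k by auto

sublocale pair_sigma_finite K lborel ..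

text \<open>At times where the integrand is not integrable the integral takes its default value 0;
  \<open>AE_integrable\<close> confines this to a null set.\<close>

definition op :: "signal \<Rightarrow> signal" where
  "op u t = (LINT x|K. k x * u (t - l x))"

lemma op_measurable [measurable]:
  assumes [measurable]: "u \<in> borel_measurable borel"
  shows "op u \<in> borel_measurable borel"
  unfolding op_def[abs_def] by measurable

text \<open>Young's inequality for an integrable kernel: Cauchy-Schwarz against the weight
  \<open>\<bar>k\<bar>\<close>, then Tonelli and translation invariance. Nonnegative integrals are
  used because convergence is what has to be established.\<close>

lemma nn_square:
  assumes "u \<in> L2"
  shows "(\<integral>\<^sup>+t. (\<integral>\<^sup>+x. ennreal \<bar>k x * u (t - l x)\<bar> \<partial>K)\<^sup>2 \<partial>lborel) < \<infinity>"
proof -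
  have [measurable]: "u \<in> borel_measurable borel" by (rule L2_measurable[OF assms])
  let ?k = "\<integral>\<^sup>+x. ennreal \<bar>k x\<bar> \<partial>K"
  have kfin: "?k < \<infinity>" using k by (simp add: integrable_iff_bounded)
  have sq: "(\<integral>\<^sup>+t. ennreal ((u (t - a))\<^sup>2) \<partial>lborel) = (\<integral>\<^sup>+t. ennreal ((u t)\<^sup>2) \<partial>lborel)" for a
    using nn_integral_real_affine[of "\<lambda>t. ennreal ((u t)\<^sup>2)" 1 "-a"] by (simp add: add.commute)
  have ufin: "(\<integral>\<^sup>+t. ennreal ((u t)\<^sup>2) \<partial>lborel) < \<infinity>"
    using L2_square[OF assms] by (simp add: integrable_iff_bounded)
  have "(\<integral>\<^sup>+x. ennreal \<bar>k x * u (t - l x)\<bar> \<partial>K)\<^sup>2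
      \<le> ?k * (\<integral>\<^sup>+x. ennreal (\<bar>k x\<bar> * (u (t - l x))\<^sup>2) \<partial>K)" for t
  proof -
    \<comment> \<open>The weight is shared equally between the two factors, so that after squaring
      each carries \<open>\<bar>k\<bar>\<close> once.\<close>
    have "(\<integral>\<^sup>+x. ennreal \<bar>k x * u (t - l x)\<bar> \<partial>K)
        = (\<integral>\<^sup>+x. ennreal (sqrt \<bar>k x\<bar>) * ennreal (sqrt \<bar>k x\<bar> * \<bar>u (t - l x)\<bar>) \<partial>K)"
      by (intro nn_integral_cong) (simp add: ennreal_mult[symmetric] abs_mult mult.assoc[symmetric])
    also have "\<dots>\<^sup>2 \<le> (\<integral>\<^sup>+x. (ennreal (sqrt \<bar>k x\<bar>))\<^sup>2 \<partial>K) *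
        (\<integral>\<^sup>+x. (ennreal (sqrt \<bar>k x\<bar> * \<bar>u (t - l x)\<bar>))\<^sup>2 \<partial>K)"
      by (rule Cauchy_Schwarz_nn_integral) simp_all
    also have "\<dots> = ?k * (\<integral>\<^sup>+x. ennreal (\<bar>k x\<bar> * (u (t - l x))\<^sup>2) \<partial>K)"
      by (simp add: ennreal_power power_mult_distrib)
    finally show ?thesis .
  qed
  then have "(\<integral>\<^sup>+t. (\<integral>\<^sup>+x. ennreal \<bar>k x * u (t - l x)\<bar> \<partial>K)\<^sup>2 \<partial>lborel)
      \<le> (\<integral>\<^sup>+t. ?k * (\<integral>\<^sup>+x. ennreal (\<bar>k x\<bar> * (u (t - l x))\<^sup>2) \<partial>K) \<partial>lborel)"
    by (intro nn_integral_mono) simp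
  also have "\<dots> = ?k * (\<integral>\<^sup>+t. (\<integral>\<^sup>+x. ennreal (\<bar>k x\<bar> * (u (t - l x))\<^sup>2) \<partial>K) \<partial>lborel)"
    by (intro nn_integral_cmult) simp
  also have "(\<integral>\<^sup>+t. (\<integral>\<^sup>+x. ennreal (\<bar>k x\<bar> * (u (t - l x))\<^sup>2) \<partial>K) \<partial>lborel)
      = (\<integral>\<^sup>+x. (\<integral>\<^sup>+t. ennreal (\<bar>k x\<bar> * (u (t - l x))\<^sup>2) \<partial>lborel) \<partial>K)"
    by (rule Fubini') simp
  also have "\<dots> = (\<integral>\<^sup>+x. ennreal \<bar>k x\<bar> * (\<integral>\<^sup>+t. ennreal ((u t)\<^sup>2) \<partial>lborel) \<partial>K)"
    by (simp add: ennreal_mult nn_integral_cmult sq)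
  also have "\<dots> = ?k * (\<integral>\<^sup>+t. ennreal ((u t)\<^sup>2) \<partial>lborel)"
    by (rule nn_integral_multc) simp
  finally show ?thesis
    using kfin ufin by (auto simp: ennreal_mult_less_top intro: le_less_trans)
qed

lemma AE_integrable:
  assumes "u \<in> L2"
  shows "AE t in lborel. integrable K (\<lambda>x. k x * u (t - l x))"
proof -
  have [measurable]: "u \<in> borel_measurable borel" by (rule L2_measurable[OF assms])
  have "AE t in lborel. (\<integral>\<^sup>+x. ennreal \<bar>k x * u (t - l x)\<bar> \<partial>K)\<^sup>2 \<noteq> \<infinity>"
    using nn_square[OF assms] by (intro nn_integral_noteq_infinite) simp_all
  then show ?thesis
    by eventually_elim (auto simp: integrable_iff_bounded power2_eq_square ennreal_mult_eq_top_iff less_top)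
qed

lemma op_L2:
  assumes "u \<in> L2"
  shows "op u \<in> L2"
proof (rule L2I)
  have [measurable]: "u \<in> borel_measurable borel" by (rule L2_measurable[OF assms])
  show [measurable]: "op u \<in> borel_measurable borel" by simp
  have "ennreal ((op u t)\<^sup>2) \<le> (\<integral>\<^sup>+x. ennreal \<bar>k x * u (t - l x)\<bar> \<partial>K)\<^sup>2" for t
  proof -
    \<comment> \<open>Holds at every \<open>t\<close>: where the integrand is not integrable,
      \<open>op u t\<close> is 0.\<close>
    have "ennreal \<bar>op u t\<bar> \<le> (\<integral>\<^sup>+x. ennreal \<bar>k x * u (t - l x)\<bar> \<partial>K)"
      using integral_norm_bound_ennreal[of K "\<lambda>x. k x * u (t - l x)"]
      by (cases "integrable K (\<lambda>x. k x * u (t - l x))")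
        (auto simp: op_def not_integrable_integral_eq)
    then have "(ennreal \<bar>op u t\<bar>)\<^sup>2 \<le> (\<integral>\<^sup>+x. ennreal \<bar>k x * u (t - l x)\<bar> \<partial>K)\<^sup>2"
      by (rule power_mono) simp
    then show ?thesis by (simp add: ennreal_power)
  qed
  then have "(\<integral>\<^sup>+t. ennreal ((op u t)\<^sup>2) \<partial>lborel)
      \<le> (\<integral>\<^sup>+t. (\<integral>\<^sup>+x. ennreal \<bar>k x * u (t - l x)\<bar> \<partial>K)\<^sup>2 \<partial>lborel)"
    by (intro nn_integral_mono) simp
  also note nn_square[OF assms]
  finally show "integrable lborel (\<lambda>t. (op u t)\<^sup>2)"
    by (simp add: integrable_iff_bounded)
qed

text \<open>Fubini on the product of the index space and time. Absolute integrability follows since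
  the inner integral of absolute values is at most \<open>\<bar>k x\<bar>\<close> times the product
  of the two norms.\<close>

lemma
  assumes "u \<in> L2" "y \<in> L2"
  shows corr_integrable: "integrable K (\<lambda>x. k x * corr u y (l x))"
    and ip_op: "ip (op u) y = (LINT x|K. k x * corr u y (l x))"
proof -
  have [measurable]: "u \<in> borel_measurable borel" "y \<in> borel_measurable borel"
    by (rule L2_measurable[OF assms(1)], rule L2_measurable[OF assms(2)])
  let ?f = "\<lambda>(x, t). k x * (u (t - l x) * y t)"
  have f: "integrable (K \<Otimes>\<^sub>M lborel) ?f"
  proof (rule Fubini_integrable)
    show "AE x in K. integrable lborel (\<lambda>t. ?f (x, t))"
      using L2_integrable_mult[OF L2_shift[OF assms(1)] assms(2)] by simp
    show "integrable K (\<lambda>x. LINT t|lborel. norm (?f (x, t)))"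
    proof (rule Bochner_Integration.integrable_bound)
      show "integrable K (\<lambda>x. l2_norm u * l2_norm y * k x)" using k by simp
      have "norm (LINT t|lborel. norm (?f (x, t))) \<le> norm (l2_norm u * l2_norm y * k x)" for x
      proof -
        have "(LINT t|lborel. norm (?f (x, t))) = \<bar>k x\<bar> * ip (\<lambda>t. \<bar>u (t - l x)\<bar>) (\<lambda>t. \<bar>y t\<bar>)"
          by (simp add: ip_def abs_mult)
        also have "\<dots> \<le> \<bar>k x\<bar> * (l2_norm u * l2_norm y)"
          using ip_abs_le_norm[OF L2_shift[OF assms(1), of "l x"] assms(2)]
          by (intro mult_left_mono) (simp_all add: l2_norm_shift)
        finally show ?thesis by (simp add: abs_mult mult.commute)
      qed
      then show "AE x in K. norm (LINT t|lborel. norm (?f (x, t))) \<le> norm (l2_norm u * l2_norm y * k x)"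
        by simp
    qed simp
  qed simp
  show "integrable K (\<lambda>x. k x * corr u y (l x))"
    using integrable_fst'[OF f] by (simp add: corr_def)
  have "ip (op u) y = (LINT t|lborel. LINT x|K. ?f (x, t))"
    by (simp add: ip_def op_def mult.assoc[symmetric])
  also have "\<dots> = (LINT x|K. LINT t|lborel. ?f (x, t))"
    by (rule Fubini_integral) (use f in simp)
  finally show "ip (op u) y = (LINT x|K. k x * corr u y (l x))"
    by (simp add: corr_def)
qed

end

section \<open>Convolution with an impulse response in \<open>HH\<close>\<close>

lemma HH_atoms: "h \<in> HH \<Longrightarrow> delays (count_space UNIV) (weight h) (loc h)"
  by (intro delays.intro delays_axioms.intro sigma_finite_measure_count_space)
    (auto simp: HH_def integrable_count_space_nat_iff)

lemma HH_dens: "h \<in> HH \<Longrightarrow> delays lborel (dens h) (\<lambda>\<tau>. \<tau>)"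
  by (intro delays.intro delays_axioms.intro lborel.sigma_finite_measure_axioms) (auto simp: HH_def)

text \<open>Shown on the definition itself, since agreement almost everywhere with a Borel function
  does not transfer Borel measurability.\<close>

lemma conv_op_measurable:
  assumes "h \<in> HH" and [measurable]: "u \<in> borel_measurable borel"
  shows "conv_op h u \<in> borel_measurable borel"
proof -
  interpret d: delays lborel "dens h" "\<lambda>\<tau>. \<tau>" by (rule HH_dens[OF assms(1)])
  have "d.op u \<in> borel_measurable borel" by (rule d.op_measurable) fact
  then have "(\<lambda>t. LINT \<tau>|lborel. dens h \<tau> * u (t - \<tau>)) \<in> borel_measurable borel"
    unfolding d.op_def[abs_def] .
  moreover have "(\<lambda>t. \<Sum>i. weight h i * u (t - loc h i)) \<in> borel_measurable borel"
    by (rule borel_measurable_suminf) simp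
  ultimately show ?thesis unfolding conv_op_def by (rule borel_measurable_add[rotated])
qed

context
  fixes h u
  assumes h: "h \<in> HH" and u: "u \<in> L2"
begin

interpretation a: delays "count_space UNIV" "weight h" "loc h" by (rule HH_atoms[OF h])
interpretation d: delays lborel "dens h" "\<lambda>\<tau>. \<tau>" by (rule HH_dens[OF h])

text \<open>The series and the integral over counting measure agree where the series converges
  absolutely, which is guaranteed only for almost every time.\<close>

lemma conv_op_AE: "ae_eq (conv_op h u) (\<lambda>t. a.op u t + d.op u t)"
  unfolding ae_eq_def using a.AE_integrable[OF u]
  by eventually_elim (simp add: conv_op_def a.op_def d.op_def integral_count_space_nat)

lemma conv_op_L2: "conv_op h u \<in> L2"
proof (rule L2_cong_AE)
  show "(\<lambda>t. a.op u t + d.op u t) \<in> L2"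
    using a.op_L2[OF u] d.op_L2[OF u] by (rule L2_add)
  show "ae_eq (\<lambda>t. a.op u t + d.op u t) (conv_op h u)"
    using conv_op_AE by (auto simp: ae_eq_def)
qed (rule conv_op_measurable[OF h L2_measurable[OF u]])

lemma
  assumes y: "y \<in> L2"
  shows corr_summable: "summable (\<lambda>i. \<bar>weight h i * corr u y (loc h i)\<bar>)"
    and corr_integrable: "integrable lborel (\<lambda>\<tau>. dens h \<tau> * corr u y \<tau>)"
    and ip_conv: "ip (conv_op h u) y =
      (\<Sum>i. weight h i * corr u y (loc h i)) + (LINT \<tau>|lborel. dens h \<tau> * corr u y \<tau>)"
proof -
  show "summable (\<lambda>i. \<bar>weight h i * corr u y (loc h i)\<bar>)"
    using a.corr_integrable[OF u y] by (simp add: integrable_count_space_nat_iff)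
  show "integrable lborel (\<lambda>\<tau>. dens h \<tau> * corr u y \<tau>)"
    using d.corr_integrable[OF u y] by simp
  have ae: "ae_eq y y" by (simp add: ae_eq_def)
  have "ip (conv_op h u) y = ip (\<lambda>t. a.op u t + d.op u t) y"
    by (rule ip_cong_AE[OF conv_op_AE ae])
      (intro L2_measurable conv_op_L2 y L2_add a.op_L2 d.op_L2 u)+
  also have "\<dots> = ip (a.op u) y + ip (d.op u) y"
    by (rule ip_add_left[OF a.op_L2[OF u] d.op_L2[OF u] y])
  also have "\<dots> = (\<Sum>i. weight h i * corr u y (loc h i)) + (LINT \<tau>|lborel. dens h \<tau> * corr u y \<tau>)"
    unfolding a.ip_op[OF u y] d.ip_op[OF u y] integral_count_space_nat[OF a.corr_integrable[OF u y]] ..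
  finally show "ip (conv_op h u) y =
      (\<Sum>i. weight h i * corr u y (loc h i)) + (LINT \<tau>|lborel. dens h \<tau> * corr u y \<tau>)" .
qed

end

lemma H_norm_nonneg: "h \<in> HH \<Longrightarrow> 0 \<le> H_norm h"
  unfolding H_norm_def HH_def by (intro add_nonneg_nonneg suminf_nonneg) auto

text \<open>Serves two values of \<open>c\<close>: the Cauchy-Schwarz bound gives the operator norm
  in \<open>l2_norm_conv\<close>, and the sharper rearrangement bound gives positivity in
  \<open>multiplier_positive\<close>.\<close>

lemma ip_conv_bound:
  assumes h: "h \<in> HH" and u: "u \<in> L2" and y: "y \<in> L2"
    and c: "\<And>\<tau>. \<bar>corr u y \<tau>\<bar> \<le> c"
  shows "\<bar>ip (conv_op h u) y\<bar> \<le> H_norm h * c"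
proof -
  have sw: "summable (\<lambda>i. \<bar>weight h i\<bar>)" and iw: "integrable lborel (dens h)"
    using h by (auto simp: HH_def)
  have "\<bar>\<Sum>i. weight h i * corr u y (loc h i)\<bar> \<le> (\<Sum>i. \<bar>weight h i * corr u y (loc h i)\<bar>)"
    by (rule summable_rabs[OF corr_summable[OF h u y]])
  also have "\<dots> \<le> (\<Sum>i. \<bar>weight h i\<bar> * c)"
    using sw c by (intro suminf_le corr_summable[OF h u y] summable_mult2)
      (auto simp: abs_mult intro!: mult_left_mono)
  also have "\<dots> = (\<Sum>i. \<bar>weight h i\<bar>) * c" by (rule suminf_mult2[OF sw, symmetric])
  finally have 1: "\<bar>\<Sum>i. weight h i * corr u y (loc h i)\<bar> \<le> (\<Sum>i. \<bar>weight h i\<bar>) * c" .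
  have "\<bar>LINT \<tau>|lborel. dens h \<tau> * corr u y \<tau>\<bar> \<le> (LINT \<tau>|lborel. \<bar>dens h \<tau> * corr u y \<tau>\<bar>)"
    by (rule integral_abs_bound)
  also have "\<dots> \<le> (LINT \<tau>|lborel. \<bar>dens h \<tau>\<bar> * c)"
    using integrable_abs[OF corr_integrable[OF h u y]] integrable_abs[OF iw] c
    by (intro integral_mono) (auto simp: abs_mult intro!: mult_left_mono)
  finally have 2: "\<bar>LINT \<tau>|lborel. dens h \<tau> * corr u y \<tau>\<bar> \<le> (LINT \<tau>|lborel. \<bar>dens h \<tau>\<bar>) * c"
    by simp
  show ?thesis using 1 2 unfolding ip_conv[OF h u y] H_norm_def distrib_right by linarith
qed

text \<open>By duality: the convolution is paired with itself and one factor of its norm is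
  cancelled.\<close>

lemma l2_norm_conv:
  assumes h: "h \<in> HH" and u: "u \<in> L2"
  shows "l2_norm (conv_op h u) \<le> H_norm h * l2_norm u"
proof -
  let ?n = "l2_norm (conv_op h u)"
  have "?n * ?n \<le> (H_norm h * l2_norm u) * ?n"
    using ip_conv_bound[OF h u conv_op_L2[OF h u] corr_le_norm[OF u conv_op_L2[OF h u]]]
    by (simp add: ip_self power2_eq_square mult.assoc)
  then show ?thesis
    using H_norm_nonneg[OF h] by (cases "?n = 0") (auto simp: less_le)
qed

text \<open>Linearity can fail at times where a series or integral has only a default value. It is
  therefore tested weakly: the defect paired with itself vanishes because \<open>corr\<close> is
  linear in its first argument.\<close>

lemma conv_op_diff:
  assumes h: "h \<in> HH" and u: "u \<in> L2" and v: "v \<in> L2"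
  shows "ae_eq (conv_op h (\<lambda>t. u t - v t)) (\<lambda>t. conv_op h u t - conv_op h v t)"
proof -
  let ?w = "\<lambda>t. conv_op h (\<lambda>t. u t - v t) t - (conv_op h u t - conv_op h v t)"
  note uv = L2_diff[OF u v]
  note L = conv_op_L2[OF h u] conv_op_L2[OF h v] conv_op_L2[OF h uv]
  have w: "?w \<in> L2" using L by (intro L2_diff)
  have "ip ?w ?w = ip (conv_op h (\<lambda>t. u t - v t)) ?w - (ip (conv_op h u) ?w - ip (conv_op h v) ?w)"
    using L w L2_diff[OF L(1,2)] by (simp add: ip_diff_left)
  also have "\<dots> = 0"
    using corr_summable[OF h u w] corr_summable[OF h v w]
      corr_integrable[OF h u w] corr_integrable[OF h v w]
    by (simp add: ip_conv h u v uv w corr_lin_left right_diff_distrib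
        suminf_diff[symmetric] summable_rabs_cancel)
  finally have "l2_norm ?w = 0" by (simp add: ip_self)
  from l2_norm_zero_AE[OF w this] show ?thesis by (simp add: ae_eq_def)
qed

text \<open>The time-reversed impulse response, which belongs to the adjoint operator.\<close>

definition reflect :: "gfun \<Rightarrow> gfun" where
  "reflect h = Gfun (weight h) (\<lambda>i. - loc h i) (\<lambda>t. dens h (- t))"

lemma reflect_HH:
  assumes "h \<in> HH"
  shows "reflect h \<in> HH"
  using assms lborel_integrable_real_affine[of "dens h" "-1" 0]
  by (auto simp: HH_def reflect_def inj_def)

lemma reflect_norm: "H_norm (reflect h) = H_norm h"
  using lborel_integral_real_affine[of "-1" "\<lambda>t. \<bar>dens h t\<bar>" 0]
  by (simp add: H_norm_def reflect_def)

text \<open>Exchanging the two signals in \<open>corr\<close> negates the lag, and the substitution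
  \<open>\<tau> \<mapsto> - \<tau>\<close> moves that sign into the impulse response.\<close>

lemma ip_conv_adjoint:
  assumes h: "h \<in> HH" and u: "u \<in> L2" and y: "y \<in> L2"
  shows "ip (conv_op h u) y = ip u (conv_op (reflect h) y)"
proof -
  have "ip u (conv_op (reflect h) y) = (\<Sum>i. weight h i * corr y u (- loc h i)) +
      (LINT \<tau>|lborel. dens h (- \<tau>) * corr y u \<tau>)"
    unfolding ip_commute[of u "conv_op (reflect h) y"] ip_conv[OF reflect_HH[OF h] y u] by (simp add: reflect_def)
  also have "(LINT \<tau>|lborel. dens h (- \<tau>) * corr y u \<tau>) = (LINT \<tau>|lborel. dens h \<tau> * corr u y \<tau>)"
    using lborel_integral_real_affine[of "-1" "\<lambda>\<tau>. dens h \<tau> * corr u y \<tau>" 0]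
    by (simp add: corr_reflect)
  finally show ?thesis by (simp add: ip_conv[OF h u y] corr_reflect)
qed

section \<open>Positivity of the multiplier\<close>

text \<open>\<open>P\<close> is the primitive of \<beta> from 0. As \<beta> may jump, the
  subgradient inequality is obtained by comparing the integrand with its endpoint values. The bounds
  on \<open>P\<close> give its integrability along a signal, and its monotonicity on the whole line
  gives Borel measurability.\<close>

lemma mono_potential:
  fixes \<beta> :: "real \<Rightarrow> real"
  assumes mono: "mono \<beta>" and "\<beta> 0 = 0"
  obtains P where "mono P" "\<And>a b. 0 \<le> a \<Longrightarrow> 0 \<le> b \<Longrightarrow> \<beta> a * (b - a) \<le> P b - P a"
    "\<And>x. 0 \<le> x \<Longrightarrow> 0 \<le> P x" "\<And>x. 0 \<le> x \<Longrightarrow> P x \<le> \<beta> x * x"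
proof -
  define P where "P x = integral {0..x} \<beta>" for x
  have int: "\<beta> integrable_on {a..b}" for a b
    using mono by (intro integrable_on_mono_on) (auto simp: mono_on_def mono_def)
  have pos: "0 \<le> x \<Longrightarrow> 0 \<le> \<beta> x" for x using monoD[OF mono, of 0 x] assms(2) by simp
  have const: "integral {a..b} (\<lambda>_. c) = c * (b - a)" if "a \<le> b" for a b c :: real
    using that by simp
  have diff: "P b - P a = integral {a..b} \<beta>" if "0 \<le> a" "a \<le> b" for a b
    using Henstock_Kurzweil_Integration.integral_combine[OF that int] by (simp add: P_def)
  have up: "integral {a..b} \<beta> \<le> \<beta> b * (b - a)" if "a \<le> b" for a b
    unfolding const[OF that, symmetric] by (intro integral_le int) (auto intro: monoD[OF mono])
  have lo: "\<beta> a * (b - a) \<le> integral {a..b} \<beta>" if "a \<le> b" for a b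
    unfolding const[OF that, symmetric] by (intro integral_le int) (auto intro: monoD[OF mono])
  have sub: "\<beta> a * (b - a) \<le> P b - P a" if "0 \<le> a" "0 \<le> b" for a b
  proof (cases "a \<le> b")
    case True
    then show ?thesis using lo diff that by simp
  next
    case False
    then have "P a - P b \<le> \<beta> a * (a - b)" using up[of b a] diff[of b a] that by simp
    then show ?thesis by (simp add: algebra_simps)
  qed
  have P0: "P 0 = 0" by (simp add: P_def)
  have nonneg: "0 \<le> P x" if "0 \<le> x" for x
    using sub[of 0 x] that assms(2) P0 by simp
  show thesis
  proof
    show "mono P"
    proof (rule monoI)
      fix x y :: real assume "x \<le> y"
      show "P x \<le> P y"
      proof (cases "0 \<le> x")
        case True
        have "0 \<le> \<beta> x * (y - x)" using pos[OF True] \<open>x \<le> y\<close> by simp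
        also have "\<dots> \<le> P y - P x" using sub True \<open>x \<le> y\<close> by simp
        finally show ?thesis by simp
      next
        case False
        \<comment> \<open>For negative \<open>x\<close> the interval of integration is
          empty.\<close>
        then have "P x = 0" by (simp add: P_def)
        moreover have "0 \<le> P y"
          by (cases "0 \<le> y") (auto simp: nonneg, simp add: P_def)
        ultimately show ?thesis by simp
      qed
    qed
    show "P x \<le> \<beta> x * x" if "0 \<le> x" for x
      using up[of 0 x] that by (simp add: P_def)
  qed (use sub nonneg in auto)
qed

text \<open>The subgradient inequality at \<open>a = \<bar>u t\<bar>\<close> and
  \<open>b = \<bar>u (t - \<tau>)\<bar>\<close> is integrated over time; the two potential terms
  cancel by translation invariance.\<close>

lemma corr_rearrangement:
  fixes \<beta> :: "real \<Rightarrow> real"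
  assumes mono: "mono \<beta>" and z: "\<beta> 0 = 0" and bdd: "\<And>x. \<bar>\<beta> x\<bar> \<le> C * \<bar>x\<bar>" and u: "u \<in> L2"
  shows "corr (\<lambda>t. \<bar>u t\<bar>) (\<lambda>t. \<beta> \<bar>u t\<bar>) \<tau> \<le> ip (\<lambda>t. \<bar>u t\<bar>) (\<lambda>t. \<beta> \<bar>u t\<bar>)"
proof -
  obtain P where P: "mono P" "\<And>a b. 0 \<le> a \<Longrightarrow> 0 \<le> b \<Longrightarrow> \<beta> a * (b - a) \<le> P b - P a"
    "\<And>x. 0 \<le> x \<Longrightarrow> 0 \<le> P x" "\<And>x. 0 \<le> x \<Longrightarrow> P x \<le> \<beta> x * x"
    using mono_potential[OF mono z] by blast
  have [measurable]: "u \<in> borel_measurable borel" "\<beta> \<in> borel_measurable borel" "P \<in> borel_measurable borel"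
    using u mono P(1) by (auto intro: L2_measurable borel_measurable_mono)
  let ?f = "\<lambda>t. \<bar>u t\<bar>" and ?g = "\<lambda>t. \<beta> \<bar>u t\<bar>"
  have f: "?f \<in> L2" by (rule L2_abs[OF u])
  have g: "?g \<in> L2" using bdd[of "\<bar>u t\<bar>" for t] by (intro L2_dominated[OF u, of _ C]) auto
  have Pi: "integrable lborel (\<lambda>t. P \<bar>u t\<bar>)"
  proof (rule Bochner_Integration.integrable_bound)
    show "integrable lborel (\<lambda>t. ?g t * ?f t)" by (rule L2_integrable_mult[OF g f])
    show "AE t in lborel. norm (P \<bar>u t\<bar>) \<le> norm (?g t * ?f t)"
      using P(3,4)[of "\<bar>u t\<bar>" for t] by (intro AE_I2) (smt (verit) abs_ge_zero real_norm_def)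
  qed simp
  have Pshift: "integrable lborel (\<lambda>t. P \<bar>u (t - \<tau>)\<bar>)"
    "(LINT t|lborel. P \<bar>u (t - \<tau>)\<bar>) = (LINT t|lborel. P \<bar>u t\<bar>)"
    using lborel_integrable_real_affine[OF Pi, of 1 "-\<tau>"]
      lborel_integral_real_affine[of 1 "\<lambda>t. P \<bar>u t\<bar>" "-\<tau>"] by (simp_all add: add.commute)
  have "corr ?f ?g \<tau> - ip ?f ?g = ip (\<lambda>t. ?f (t - \<tau>) - ?f t) ?g"
    using ip_diff_left[OF L2_shift[OF f, of \<tau>] f g] by (simp add: corr_def ip_def)
  also have "\<dots> \<le> (LINT t|lborel. P \<bar>u (t - \<tau>)\<bar> - P \<bar>u t\<bar>)"
    unfolding ip_def using Pi Pshift(1) P(2)[of "\<bar>u t\<bar>" "\<bar>u (t - \<tau>)\<bar>" for t]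
    by (intro integral_mono L2_integrable_mult L2_diff L2_shift[OF f] f g)
      (auto simp: mult.commute)
  also have "\<dots> = 0" using Pi Pshift by simp
  finally show ?thesis by simp
qed

text \<open>A relation between two signals rather than a property of an operator, so that spliced
  outputs can satisfy it. The product condition says that the signs agree; avoiding quotients also
  covers \<open>u t = 0\<close>.\<close>

definition sector :: "(real \<Rightarrow> real) \<Rightarrow> real \<Rightarrow> signal \<Rightarrow> signal \<Rightarrow> bool" where
  "sector \<beta> B u y \<longleftrightarrow> (AE t in lborel.
     u t * y t = \<bar>u t\<bar> * \<bar>y t\<bar> \<and> \<beta> \<bar>u t\<bar> \<le> \<bar>y t\<bar> \<and> \<bar>y t\<bar> \<le> B * \<beta> \<bar>u t\<bar>)"

lemma sector_dominated:
  assumes "sector \<beta> B u y" "0 \<le> B" "\<And>x. \<bar>\<beta> x\<bar> \<le> C * \<bar>x\<bar>"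
  shows "AE t in lborel. \<bar>y t\<bar> \<le> (B * C) * \<bar>u t\<bar>"
  using assms(1) unfolding sector_def
proof eventually_elim
  case (elim t)
  have "\<beta> \<bar>u t\<bar> \<le> C * \<bar>u t\<bar>" using assms(3)[of "\<bar>u t\<bar>"] by simp
  then have "B * \<beta> \<bar>u t\<bar> \<le> B * (C * \<bar>u t\<bar>)" using assms(2) by (rule mult_left_mono)
  with elim show ?case by (simp add: mult.assoc)
qed

lemma multiplier_L2: "h \<in> HH \<Longrightarrow> u \<in> L2 \<Longrightarrow> multiplier h u \<in> L2"
  unfolding multiplier_def by (intro L2_diff conv_op_L2)

lemma ip_multiplier:
  "h \<in> HH \<Longrightarrow> u \<in> L2 \<Longrightarrow> y \<in> L2 \<Longrightarrow> ip (multiplier h u) y = ip u y - ip (conv_op h u) y"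
  unfolding multiplier_def by (intro ip_diff_left conv_op_L2)

lemma multiplier_positive:
  assumes h: "h \<in> HH" and hB: "B * H_norm h \<le> 1" and B: "0 \<le> B"
    and mono: "mono \<beta>" and z: "\<beta> 0 = 0" and bdd: "\<And>x. \<bar>\<beta> x\<bar> \<le> C * \<bar>x\<bar>"
    and u: "u \<in> L2" and y: "y \<in> L2" and sec: "sector \<beta> B u y"
  shows "0 \<le> ip (multiplier h u) y"
proof -
  let ?f = "\<lambda>t. \<bar>u t\<bar>" and ?g = "\<lambda>t. \<beta> \<bar>u t\<bar>"
  have [measurable]: "u \<in> borel_measurable borel" "\<beta> \<in> borel_measurable borel" "y \<in> borel_measurable borel"
    using u y mono by (auto intro: L2_measurable borel_measurable_mono)
  have f: "?f \<in> L2" by (rule L2_abs[OF u])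
  have g: "?g \<in> L2" using bdd[of "\<bar>u t\<bar>" for t] by (intro L2_dominated[OF u, of _ C]) auto
  \<comment> \<open>The lower sector bound; it also shows that \<open>ip u y\<close> is
    nonnegative.\<close>
  have "ip ?f ?g \<le> ip u y"
    unfolding ip_def
  proof (rule integral_mono_AE)
    show "AE t in lborel. ?f t * ?g t \<le> u t * y t"
      using sec unfolding sector_def by eventually_elim (auto intro: mult_left_mono)
  qed (rule L2_integrable_mult[OF f g], rule L2_integrable_mult[OF u y])
  moreover have "0 \<le> ip ?f ?g"
    unfolding ip_def using monoD[OF mono, of 0] z
    by (intro Bochner_Integration.integral_nonneg mult_nonneg_nonneg) auto
  ultimately have uy: "0 \<le> ip u y" by simp
  \<comment> \<open>The upper sector bound replaces \<open>y\<close> by \<beta> of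
    \<open>\<bar>u\<bar>\<close>, rearrangement removes the lag, and the lower bound returns to
    \<open>y\<close>. The total loss is the single factor \<open>B\<close>.\<close>
  have corr: "\<bar>corr u y \<tau>\<bar> \<le> B * ip u y" for \<tau>
  proof -
    have "\<bar>corr u y \<tau>\<bar> \<le> (LINT t|lborel. \<bar>u (t - \<tau>) * y t\<bar>)"
      unfolding corr_def by (rule integral_abs_bound)
    also have "\<dots> \<le> (LINT t|lborel. B * (?f (t - \<tau>) * ?g t))"
    proof (rule integral_mono_AE)
      show "integrable lborel (\<lambda>t. \<bar>u (t - \<tau>) * y t\<bar>)"
        by (intro integrable_abs L2_integrable_mult L2_shift u y)
      show "integrable lborel (\<lambda>t. B * (?f (t - \<tau>) * ?g t))"
        using L2_integrable_mult[OF L2_shift[OF f] g] by simp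
      show "AE t in lborel. \<bar>u (t - \<tau>) * y t\<bar> \<le> B * (?f (t - \<tau>) * ?g t)"
        using sec unfolding sector_def
      proof eventually_elim
        case (elim t)
        then have "\<bar>u (t - \<tau>)\<bar> * \<bar>y t\<bar> \<le> \<bar>u (t - \<tau>)\<bar> * (B * \<beta> \<bar>u t\<bar>)"
          by (intro mult_left_mono) auto
        then show ?case by (simp add: abs_mult mult_ac)
      qed
    qed
    also have "\<dots> = B * corr ?f ?g \<tau>" by (simp add: corr_def)
    also have "\<dots> \<le> B * ip ?f ?g"
      using corr_rearrangement[OF mono z bdd u] B by (intro mult_left_mono)
    also have "\<dots> \<le> B * ip u y" using \<open>ip ?f ?g \<le> ip u y\<close> B by (intro mult_left_mono)
    finally show ?thesis .
  qed
  have "\<bar>ip (conv_op h u) y\<bar> \<le> H_norm h * (B * ip u y)"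
    by (rule ip_conv_bound[OF h u y corr])
  also have "\<dots> = (B * H_norm h) * ip u y" by simp
  also have "\<dots> \<le> 1 * ip u y" using hB uy by (rule mult_right_mono)
  finally show ?thesis using ip_multiplier[OF h u y] by simp
qed

text \<open>For odd \<open>lo\<close> the quotient \<open>lo x / x\<close> depends only on
  \<open>\<bar>x\<bar>\<close>, so bounds on quotients become bounds on absolute values; a
  nonnegative quotient means equal signs. At \<open>u t = 0\<close> both \<open>lo\<close> and the
  output vanish.\<close>

lemma nonlinearity_sector:
  assumes bounds: "nonlinearity_bounded \<phi> lo hi"
    and zero: "\<forall>u\<in>L2e. AE t in lborel. u t = 0 \<longrightarrow> \<phi> u t = 0"
    and nonneg: "\<forall>x. x \<noteq> 0 \<longrightarrow> lo x / x \<ge> 0"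
    and "odd_fun lo" and above: "bounded_above_by hi (\<lambda>x. B * lo x)" and u: "u \<in> L2e"
  shows "sector lo B u (\<phi> u)"
proof -
  have odd: "lo (- x) = - lo x" for x using assms(4) by (simp add: odd_fun_def)
  then have lo0: "lo 0 = 0" by (metis add.inverse_neutral equation_minus_iff neg_equal_zero)
  have "AE t in lborel. u t = 0 \<longrightarrow> \<phi> u t = 0" using zero u by blast
  moreover have "AE t in lborel. u t \<noteq> 0 \<longrightarrow>
      lo (u t) / u t \<le> \<phi> u t / u t \<and> \<phi> u t / u t \<le> hi (u t) / u t"
    using bounds u by (auto simp: nonlinearity_bounded_def)
  ultimately show ?thesis unfolding sector_def
  proof eventually_elim
    case (elim t)
    show ?case
    proof (cases "u t = 0")
      case True
      with elim show ?thesis by (simp add: lo0)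
    next
      case False
      let ?x = "u t" and ?y = "\<phi> u t"
      have eq: "lo \<bar>?x\<bar> / \<bar>?x\<bar> = lo ?x / ?x" by (auto simp: abs_if odd)
      have 1: "lo ?x / ?x \<le> ?y / ?x" using elim False by simp
      have 2: "?y / ?x \<le> B * lo ?x / ?x"
        using elim False above order_trans unfolding bounded_above_by_def by blast
      have 3: "0 \<le> ?y / ?x" using 1 nonneg False order_trans by blast
      then have q: "?y / ?x = \<bar>?y\<bar> / \<bar>?x\<bar>" by (metis abs_divide abs_of_nonneg)
      have a: "0 < \<bar>?x\<bar>" using False by simp
      have "lo \<bar>?x\<bar> \<le> \<bar>?y\<bar>" using 1 a unfolding q eq[symmetric] by (simp add: divide_le_cancel)
      moreover have "\<bar>?y\<bar> \<le> B * lo \<bar>?x\<bar>"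
        using 2 a unfolding q times_divide_eq_right[symmetric] eq[symmetric]
        by (simp add: divide_le_cancel)
      moreover have "?x * ?y = \<bar>?x\<bar> * \<bar>?y\<bar>"
        using 3 by (metis abs_mult abs_of_nonneg mult.commute zero_le_divide_iff mult_nonneg_nonneg mult_nonpos_nonpos)
      ultimately show ?thesis by simp
    qed
  qed
qed

text \<open>Sector conditions are pointwise, so a relation known up to time \<open>T\<close> can be continued by
  the memoryless \<open>\<beta>\<close>.\<close>

lemma sector_extend:
  assumes sec: "sector \<beta> B u y" and odd: "odd_fun \<beta>" and mono: "mono \<beta>" and B: "1 \<le> B"
    and a: "trunc T a = trunc T u"
  shows "sector \<beta> B a (\<lambda>t. if t \<le> T then y t else \<beta> (a t))"
  using sec unfolding sector_def
proof eventually_elim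
  case (elim t)
  show ?case
  proof (cases "t \<le> T")
    case True
    then have "a t = u t" using fun_cong[OF a, of t] by (simp add: trunc_def)
    with elim True show ?thesis by simp
  next
    case False
    have o: "\<beta> (- x) = - \<beta> x" for x using odd by (simp add: odd_fun_def)
    then have b0: "\<beta> 0 = 0" by (metis add.inverse_neutral equation_minus_iff neg_equal_zero)
    have nn: "0 \<le> x \<Longrightarrow> 0 \<le> \<beta> x" for x using monoD[OF mono, of 0 x] b0 by simp
    have e: "\<bar>\<beta> (a t)\<bar> = \<beta> \<bar>a t\<bar>" "a t * \<beta> (a t) = \<bar>a t\<bar> * \<beta> \<bar>a t\<bar>"
      using nn[of "\<bar>a t\<bar>"] by (auto simp: abs_if o)
    have "1 * \<beta> \<bar>a t\<bar> \<le> B * \<beta> \<bar>a t\<bar>" using B nn by (intro mult_right_mono) auto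
    with e False show ?thesis by simp
  qed
qed

section \<open>Gaussian summation of Fourier integrals\<close>

lemma l2_norm_square: "(l2_norm x)\<^sup>2 = (LINT t|lborel. (x t)\<^sup>2)"
  by (simp add: l2_norm_def)

text \<open>The literal Fourier integral, meant for integrable signals. The relation
  \<open>fourier_transform\<close> is the mean-square extension, and the two are linked by
  \<open>nice_fourier_transform\<close>.\<close>

definition FT :: "signal \<Rightarrow> real \<Rightarrow> complex" where
  "FT x \<omega> = (LINT t|lborel. complex_of_real (x t) * cis (- (\<omega> * t)))"

lemma cis_measurable [measurable]: "cis \<in> borel_measurable borel"
  by (intro borel_measurable_continuous_onI continuous_intros)

lemma integrable_cis_mult:
  fixes f :: "'a \<Rightarrow> complex"
  assumes "integrable M f" and [measurable]: "g \<in> borel_measurable M"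
  shows "integrable M (\<lambda>x. f x * cis (g x))"
proof (rule Bochner_Integration.integrable_bound[OF assms(1)])
  have [measurable]: "f \<in> borel_measurable M" using assms(1) by auto
  show "(\<lambda>x. f x * cis (g x)) \<in> borel_measurable M" by measurable
qed (simp add: norm_mult)

lemma FT_measurable [measurable]:
  assumes [measurable]: "x \<in> borel_measurable borel"
  shows "FT x \<in> borel_measurable borel"
  unfolding FT_def[abs_def] by measurable

lemma FT_le:
  assumes "integrable lborel x"
  shows "cmod (FT x \<omega>) \<le> (LINT t|lborel. \<bar>x t\<bar>)"
proof -
  have "cmod (FT x \<omega>) \<le> (LINT t|lborel. cmod (complex_of_real (x t) * cis (- (\<omega> * t))))"
    unfolding FT_def by (rule integral_norm_bound)
  then show ?thesis by (simp add: norm_mult)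
qed

lemma FT_shift: "FT (\<lambda>t. x (t + \<tau>)) \<omega> = cis (\<omega> * \<tau>) * FT x \<omega>"
proof -
  have "FT x \<omega> = (LINT t|lborel. complex_of_real (x (\<tau> + 1 * t)) * cis (- (\<omega> * (\<tau> + 1 * t))))"
    unfolding FT_def by (subst lborel_integral_real_affine[of 1 _ \<tau>]) simp_all
  also have "\<dots> = (LINT t|lborel. cis (- (\<omega> * \<tau>)) * (complex_of_real (x (t + \<tau>)) * cis (- (\<omega> * t))))"
    by (intro Bochner_Integration.integral_cong) (simp_all add: algebra_simps cis_mult)
  also have "\<dots> = cis (- (\<omega> * \<tau>)) * FT (\<lambda>t. x (t + \<tau>)) \<omega>"
    unfolding FT_def by simp
  finally show ?thesis by (simp add: mult.assoc[symmetric] cis_mult)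
qed

section \<open>The Gaussian convergence factor and its transform\<close>

definition gauss :: "real \<Rightarrow> real \<Rightarrow> real" where
  "gauss \<sigma> \<omega> = exp (- (\<sigma> * \<omega>)\<^sup>2 / 2)"

text \<open>The centered normal density with standard deviation \<sigma>. As \<sigma> tends to 0,
  \<open>gauss\<close> tends to 1 while \<open>kern\<close> concentrates at the origin.\<close>

definition kern :: "real \<Rightarrow> real \<Rightarrow> real" where
  "kern \<sigma> x = std_normal_density (x / \<sigma>) / \<sigma>"

lemma gauss_measurable [measurable]: "gauss \<sigma> \<in> borel_measurable borel"
  unfolding gauss_def[abs_def] by measurable

lemma kern_measurable [measurable]: "kern \<sigma> \<in> borel_measurable borel"
  unfolding kern_def[abs_def] by measurable

lemma gauss_bounds: "0 < gauss \<sigma> \<omega>" "gauss \<sigma> \<omega> \<le> 1"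
  by (simp_all add: gauss_def)

lemma gauss_std: "gauss \<sigma> \<omega> = sqrt (2 * pi) * std_normal_density (\<sigma> * \<omega>)"
  by (simp add: gauss_def std_normal_density_def)

lemma gauss_integrable:
  assumes "0 < \<sigma>"
  shows "integrable lborel (gauss \<sigma>)"
  using lborel_integrable_real_affine[OF integrable_normal_density[of 1 0], of \<sigma> 0] assms
  unfolding gauss_std[abs_def] by simp

text \<open>The characteristic function of the standard normal distribution at
  \<open>x / \<sigma>\<close>, after rescaling the frequency by \<sigma>.\<close>

lemma gauss_transform:
  assumes "0 < \<sigma>"
  shows "(LINT \<omega>|lborel. complex_of_real (gauss \<sigma> \<omega>) * cis (\<omega> * x)) = complex_of_real (2 * pi * kern \<sigma> x)"
proof -
  let ?f = "\<lambda>z. std_normal_density z *\<^sub>R iexp (x / \<sigma> * z)"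
  have "char std_normal_distribution (x / \<sigma>) = (LINT z|lborel. ?f z)"
    unfolding char_def by (subst integral_density) auto
  then have "complex_of_real (exp (- ((x / \<sigma>)\<^sup>2) / 2)) = (LINT z|lborel. ?f z)"
    by (simp add: char_std_normal_distribution)
  also have "\<dots> = \<sigma> *\<^sub>R (LINT \<omega>|lborel. ?f (0 + \<sigma> * \<omega>))"
    using assms by (subst lborel_integral_real_affine[of \<sigma> _ 0]) simp_all
  also have "(\<lambda>\<omega>. ?f (0 + \<sigma> * \<omega>)) = (\<lambda>\<omega>. complex_of_real (1 / sqrt (2 * pi)) * (complex_of_real (gauss \<sigma> \<omega>) * cis (\<omega> * x)))"
    using assms by (auto simp: gauss_std cis_conv_exp scaleR_conv_of_real mult_ac)
  also have "(LINT \<omega>|lborel. complex_of_real (1 / sqrt (2 * pi)) * (complex_of_real (gauss \<sigma> \<omega>) * cis (\<omega> * x)))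
      = complex_of_real (1 / sqrt (2 * pi)) * (LINT \<omega>|lborel. complex_of_real (gauss \<sigma> \<omega>) * cis (\<omega> * x))"
    by (rule integral_mult_right_zero)
  finally have e: "complex_of_real (exp (- ((x / \<sigma>)\<^sup>2) / 2)) =
      complex_of_real (\<sigma> / sqrt (2 * pi)) * (LINT \<omega>|lborel. complex_of_real (gauss \<sigma> \<omega>) * cis (\<omega> * x))"
    by (simp add: scaleR_conv_of_real)
  have "exp (- ((x / \<sigma>)\<^sup>2) / 2) = \<sigma> / sqrt (2 * pi) * (2 * pi * kern \<sigma> x)"
    using assms by (simp add: kern_def std_normal_density_def)
  then have "complex_of_real (\<sigma> / sqrt (2 * pi)) * complex_of_real (2 * pi * kern \<sigma> x)
      = complex_of_real (\<sigma> / sqrt (2 * pi)) * (LINT \<omega>|lborel. complex_of_real (gauss \<sigma> \<omega>) * cis (\<omega> * x))"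
    unfolding e[symmetric] of_real_mult[symmetric] by simp
  moreover have "complex_of_real (\<sigma> / sqrt (2 * pi)) \<noteq> 0"
    using assms pi_gt_zero by (simp only: of_real_eq_0_iff) simp
  ultimately show ?thesis by (metis mult_cancel_left)
qed

lemma kern_nonneg: "0 < \<sigma> \<Longrightarrow> 0 \<le> kern \<sigma> x"
  by (simp add: kern_def)

text \<open>The substitution \<open>t = s + \<sigma> * z\<close> moves \<sigma> from the kernel into
  the argument of \<open>f\<close>, leaving a fixed density as the dominating weight for
  limits.\<close>

lemma kern_average:
  fixes f :: "real \<Rightarrow> real"
  assumes "0 < \<sigma>"
  shows "(LINT t|lborel. f t * kern \<sigma> (t - s)) = (LINT z|lborel. f (s + \<sigma> * z) * std_normal_density z)"
    and "integrable lborel (\<lambda>t. f t * kern \<sigma> (t - s)) \<longleftrightarrow>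
      integrable lborel (\<lambda>z. f (s + \<sigma> * z) * std_normal_density z)"
proof -
  have *: "(\<lambda>z. f (s + \<sigma> * z) * kern \<sigma> ((s + \<sigma> * z) - s)) = (\<lambda>z. (1 / \<sigma>) * (f (s + \<sigma> * z) * std_normal_density z))"
    using assms by (simp add: kern_def)
  show "(LINT t|lborel. f t * kern \<sigma> (t - s)) = (LINT z|lborel. f (s + \<sigma> * z) * std_normal_density z)"
    using assms by (subst lborel_integral_real_affine[of \<sigma> _ s]) (simp_all only: *, simp_all)
  show "integrable lborel (\<lambda>t. f t * kern \<sigma> (t - s)) \<longleftrightarrow>
      integrable lborel (\<lambda>z. f (s + \<sigma> * z) * std_normal_density z)"
    using lborel_integrable_real_affine_iff[of \<sigma> "\<lambda>t. f t * kern \<sigma> (t - s)" s] assms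
    unfolding * integrable_mult_left_iff by simp
qed

lemma kern_integral:
  assumes "0 < \<sigma>"
  shows "(LINT t|lborel. kern \<sigma> (t - s)) = 1" "integrable lborel (\<lambda>t. kern \<sigma> (t - s))"
  using kern_average[OF assms, of "\<lambda>_. 1" s] by simp_all

lemma kern_sym: "kern \<sigma> (s - t) = kern \<sigma> (t - s)"
  by (simp add: kern_def std_normal_density_def power2_commute diff_divide_distrib)

text \<open>Provides Fubini between the frequency and the pair of times in
  \<open>gauss_parseval\<close>.\<close>

interpretation LLL: pair_sigma_finite lborel "lborel \<Otimes>\<^sub>M lborel :: (real \<times> real) measure" ..

lemma integrable_tensor:
  fixes f g :: "real \<Rightarrow> 'a::{real_normed_field, banach, second_countable_topology}"
  assumes "integrable lborel f" "integrable lborel g"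
  shows "integrable (lborel \<Otimes>\<^sub>M lborel) (\<lambda>(s, t). f s * g t)"
proof (rule lborel_pair.Fubini_integrable)
  have [measurable]: "f \<in> borel_measurable lborel" "g \<in> borel_measurable lborel" using assms by auto
  show "(\<lambda>(s, t). f s * g t) \<in> borel_measurable (lborel \<Otimes>\<^sub>M lborel)" by measurable
  show "integrable lborel (\<lambda>s. LINT t|lborel. norm (case (s, t) of (s, t) \<Rightarrow> f s * g t))"
    using assms by (simp add: norm_mult)
qed (use assms in simp)

lemma integral_tensor:
  fixes f g :: "real \<Rightarrow> 'a::{real_normed_field, banach, second_countable_topology}"
  assumes "integrable lborel f" "integrable lborel g"
  shows "(LINT (s, t)|(lborel \<Otimes>\<^sub>M lborel). f s * g t) = (LINT s|lborel. f s) * (LINT t|lborel. g t)"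
  using lborel_pair.integral_fst[OF integrable_tensor[OF assms]] by simp

text \<open>The product of the transforms is a double integral over times. The Gaussian factor makes
  the triple integral absolutely convergent, and integrating over the frequency first leaves
  \<open>kern\<close> at the time difference.\<close>

lemma gauss_parseval:
  assumes f: "integrable lborel f" and g: "integrable lborel g" and \<sigma>: "0 < \<sigma>"
  shows "(LINT \<omega>|lborel. complex_of_real (gauss \<sigma> \<omega>) * (FT f \<omega> * cnj (FT g \<omega>))) =
    complex_of_real (2 * pi * (LINT (s, t)|(lborel \<Otimes>\<^sub>M lborel). f s * g t * kern \<sigma> (t - s)))"
proof -
  have [measurable]: "f \<in> borel_measurable lborel" "g \<in> borel_measurable lborel" using f g by auto
  let ?E = "\<lambda>\<omega> p. complex_of_real (f (fst p)) * cis (- (\<omega> * fst p)) * (complex_of_real (g (snd p)) * cis (\<omega> * snd p))"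
  let ?F = "\<lambda>\<omega> p. complex_of_real (gauss \<sigma> \<omega>) * ?E \<omega> p"
  have cf: "integrable lborel (\<lambda>s. complex_of_real (f s) * cis (- (\<omega> * s)))" for \<omega>
    using f by (intro integrable_cis_mult integrable_of_real) auto
  have cg: "integrable lborel (\<lambda>s. complex_of_real (g s) * cis (\<omega> * s))" for \<omega>
    using g by (intro integrable_cis_mult integrable_of_real) auto
  have cnjFT: "cnj (FT g \<omega>) = (LINT t|lborel. complex_of_real (g t) * cis (\<omega> * t))" for \<omega>
    using Bochner_Integration.integral_cnj[of lborel "\<lambda>t. complex_of_real (g t) * cis (- (\<omega> * t))"]
    by (simp add: FT_def cis_cnj)
  have EI: "integrable (lborel \<Otimes>\<^sub>M lborel) (?E \<omega>)"
    and Eint: "(LINT p|(lborel \<Otimes>\<^sub>M lborel). ?E \<omega> p) = FT f \<omega> * cnj (FT g \<omega>)" for \<omega>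
    using integrable_tensor[OF cf cg] integral_tensor[OF cf cg]
    unfolding cnjFT unfolding FT_def by (simp_all add: case_prod_unfold)
  have nE: "norm (?F \<omega> p) = gauss \<sigma> \<omega> * norm (f (fst p) * g (snd p))" for \<omega> p
    using gauss_bounds[of \<sigma> \<omega>] by (simp add: norm_mult abs_mult)
  have fg: "integrable (lborel \<Otimes>\<^sub>M lborel) (\<lambda>p. f (fst p) * g (snd p))"
    using integrable_tensor[OF f g] by (simp add: case_prod_unfold)
  have I: "integrable (lborel \<Otimes>\<^sub>M (lborel \<Otimes>\<^sub>M lborel)) (case_prod ?F)"
  proof (rule LLL.Fubini_integrable)
    show "case_prod ?F \<in> borel_measurable (lborel \<Otimes>\<^sub>M (lborel \<Otimes>\<^sub>M lborel))" by measurable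
    show "AE \<omega> in lborel. integrable (lborel \<Otimes>\<^sub>M lborel) (\<lambda>p. case_prod ?F (\<omega>, p))"
      using EI by simp
    show "integrable lborel (\<lambda>\<omega>. LINT p|(lborel \<Otimes>\<^sub>M lborel). norm (case_prod ?F (\<omega>, p)))"
      unfolding prod.case nE using gauss_integrable[OF \<sigma>] by simp
  qed
  have inner: "(LINT \<omega>|lborel. ?F \<omega> p) =
      complex_of_real (2 * pi * (f (fst p) * g (snd p) * kern \<sigma> (snd p - fst p)))" for p
  proof -
    have "?F \<omega> p = complex_of_real (f (fst p) * g (snd p)) *
        (complex_of_real (gauss \<sigma> \<omega>) * cis (\<omega> * (snd p - fst p)))" for \<omega>
      using cis_mult[of "- (\<omega> * fst p)" "\<omega> * snd p"] by (simp add: algebra_simps)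
    then have "(LINT \<omega>|lborel. ?F \<omega> p) = complex_of_real (f (fst p) * g (snd p)) *
        (LINT \<omega>|lborel. complex_of_real (gauss \<sigma> \<omega>) * cis (\<omega> * (snd p - fst p)))"
      by (simp only: integral_mult_right_zero)
    then show ?thesis unfolding gauss_transform[OF \<sigma>] of_real_mult[symmetric] by (simp add: mult_ac)
  qed
  have "(LINT \<omega>|lborel. complex_of_real (gauss \<sigma> \<omega>) * (FT f \<omega> * cnj (FT g \<omega>)))
      = (LINT \<omega>|lborel. LINT p|(lborel \<Otimes>\<^sub>M lborel). ?F \<omega> p)"
    unfolding Eint[symmetric] by simp
  also have "\<dots> = (LINT p|(lborel \<Otimes>\<^sub>M lborel). LINT \<omega>|lborel. ?F \<omega> p)"
    by (rule LLL.Fubini_integral[OF I, symmetric])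
  also have "\<dots> = complex_of_real (2 * pi * (LINT p|(lborel \<Otimes>\<^sub>M lborel). f (fst p) * g (snd p) * kern \<sigma> (snd p - fst p)))"
    unfolding inner integral_complex_of_real integral_mult_right_zero ..
  finally show ?thesis by (simp add: case_prod_unfold)
qed

text \<open>The Gaussian means of the squared transform are bounded uniformly in \<sigma>, and
  Fatou's lemma removes the factor. This inequality comes before the identity, where it supplies the
  dominating function.\<close>

lemma plancherel_integrable:
  assumes x: "x \<in> L2" "integrable lborel x"
  shows "integrable lborel (\<lambda>\<omega>. (cmod (FT x \<omega>))\<^sup>2)"
proof -
  have [measurable]: "x \<in> borel_measurable borel" by (rule L2_measurable[OF x(1)])
  define N where "N = (LINT t|lborel. \<bar>x t\<bar>)"
  have bound: "(\<integral>\<^sup>+\<omega>. ennreal (gauss \<sigma> \<omega> * (cmod (FT x \<omega>))\<^sup>2) \<partial>lborel) \<le> ennreal (2 * pi * (l2_norm x)\<^sup>2)"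
    if \<sigma>: "0 < \<sigma>" for \<sigma>
  proof -
    have int: "integrable lborel (\<lambda>\<omega>. gauss \<sigma> \<omega> * (cmod (FT x \<omega>))\<^sup>2)"
    proof (rule Bochner_Integration.integrable_bound)
      show "integrable lborel (\<lambda>\<omega>. gauss \<sigma> \<omega> * N\<^sup>2)" using gauss_integrable[OF \<sigma>] by simp
      show "AE \<omega> in lborel. norm (gauss \<sigma> \<omega> * (cmod (FT x \<omega>))\<^sup>2) \<le> norm (gauss \<sigma> \<omega> * N\<^sup>2)"
        using FT_le[OF x(2)] gauss_bounds(1)[of \<sigma>]
        by (intro AE_I2) (auto simp: abs_mult N_def less_imp_le intro!: mult_left_mono power_mono)
    qed measurable
    \<comment> \<open>These majorize \<open>x s * x t * kern \<sigma> (t - s)\<close> through the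
      arithmetic-geometric mean inequality. Each integrates to the squared norm, since
      \<open>kern\<close> has mass 1 and is symmetric.\<close>
    let ?k = "\<lambda>(s, t). (x s)\<^sup>2 * kern \<sigma> (t - s)" and ?k' = "\<lambda>(s, t). (x t)\<^sup>2 * kern \<sigma> (t - s)"
    have k: "integrable (lborel \<Otimes>\<^sub>M lborel) ?k"
    proof (rule lborel_pair.Fubini_integrable)
      show "integrable lborel (\<lambda>s. LINT t|lborel. norm (?k (s, t)))"
        using L2_square[OF x(1)] kern_integral[OF \<sigma>] by (simp add: abs_mult kern_nonneg[OF \<sigma>])
    qed (use kern_integral[OF \<sigma>] in auto)
    have kint: "(LINT p|(lborel \<Otimes>\<^sub>M lborel). ?k p) = (l2_norm x)\<^sup>2"
      unfolding l2_norm_square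
      using lborel_pair.integral_fst[OF k] kern_integral[OF \<sigma>] by simp
    have swap: "(\<lambda>(s, t). ?k (t, s)) = ?k'" by (auto simp: kern_sym)
    have k': "integrable (lborel \<Otimes>\<^sub>M lborel) ?k'"
      using lborel_pair.integrable_product_swap[OF k] unfolding swap .
    have kint': "(LINT p|(lborel \<Otimes>\<^sub>M lborel). ?k' p) = (l2_norm x)\<^sup>2"
      using lborel_pair.integral_product_swap[of ?k] k unfolding swap kint by auto
    have "complex_of_real (gauss \<sigma> \<omega>) * (FT x \<omega> * cnj (FT x \<omega>)) =
        complex_of_real (gauss \<sigma> \<omega> * (cmod (FT x \<omega>))\<^sup>2)" for \<omega>
      by (simp only: of_real_mult complex_norm_square)
    then have "complex_of_real (LINT \<omega>|lborel. gauss \<sigma> \<omega> * (cmod (FT x \<omega>))\<^sup>2) =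
        (LINT \<omega>|lborel. complex_of_real (gauss \<sigma> \<omega>) * (FT x \<omega> * cnj (FT x \<omega>)))"
      by (simp only: integral_complex_of_real)
    then have "(LINT \<omega>|lborel. gauss \<sigma> \<omega> * (cmod (FT x \<omega>))\<^sup>2) =
        2 * pi * (LINT (s, t)|(lborel \<Otimes>\<^sub>M lborel). x s * x t * kern \<sigma> (t - s))"
      unfolding gauss_parseval[OF x(2,2) \<sigma>] of_real_eq_iff .
    also have "(LINT (s, t)|(lborel \<Otimes>\<^sub>M lborel). x s * x t * kern \<sigma> (t - s))
        \<le> (LINT p|(lborel \<Otimes>\<^sub>M lborel). (?k p + ?k' p) / 2)"
    proof (rule integral_mono_AE')
      show "integrable (lborel \<Otimes>\<^sub>M lborel) (\<lambda>p. (?k p + ?k' p) / 2)" using k k' by simp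
      have "x s * x t * kern \<sigma> (t - s) \<le> (((x s)\<^sup>2 + (x t)\<^sup>2) / 2) * kern \<sigma> (t - s)" for s t
        using sum_squares_bound[of "x s" "x t"] by (intro mult_right_mono kern_nonneg[OF \<sigma>]) simp
      then show "AE p in lborel \<Otimes>\<^sub>M lborel. (case p of (s, t) \<Rightarrow> x s * x t * kern \<sigma> (t - s)) \<le> (?k p + ?k' p) / 2"
        by (intro AE_I2) (auto simp: algebra_simps split: prod.splits)
      show "AE p in lborel \<Otimes>\<^sub>M lborel. 0 \<le> (?k p + ?k' p) / 2"
        by (intro AE_I2) (auto simp: kern_nonneg[OF \<sigma>] split: prod.splits)
    qed
    also have "\<dots> = (l2_norm x)\<^sup>2" using k k' kint kint' by simp
    finally have "(LINT \<omega>|lborel. gauss \<sigma> \<omega> * (cmod (FT x \<omega>))\<^sup>2) \<le> 2 * pi * (l2_norm x)\<^sup>2" by simp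
    then show ?thesis using gauss_bounds(1)[of \<sigma>]
      by (subst nn_integral_eq_integral[OF int]) (auto simp: less_imp_le intro!: ennreal_leI)
  qed
  define \<sigma> where "\<sigma> n = inverse (real (Suc n))" for n
  have lim: "(\<lambda>n. ennreal (gauss (\<sigma> n) \<omega> * (cmod (FT x \<omega>))\<^sup>2)) \<longlonglongrightarrow> ennreal ((cmod (FT x \<omega>))\<^sup>2)" for \<omega>
  proof -
    have "(\<lambda>n. gauss (\<sigma> n) \<omega> * (cmod (FT x \<omega>))\<^sup>2) \<longlonglongrightarrow> exp (- (0 * \<omega>)\<^sup>2 / 2) * (cmod (FT x \<omega>))\<^sup>2"
      unfolding gauss_def \<sigma>_def by (intro tendsto_intros LIMSEQ_inverse_real_of_nat) simp
    then show ?thesis by (intro tendsto_ennrealI) simp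
  qed
  have "(\<integral>\<^sup>+\<omega>. ennreal ((cmod (FT x \<omega>))\<^sup>2) \<partial>lborel) =
      (\<integral>\<^sup>+\<omega>. liminf (\<lambda>n. ennreal (gauss (\<sigma> n) \<omega> * (cmod (FT x \<omega>))\<^sup>2)) \<partial>lborel)"
    by (intro nn_integral_cong) (simp add: lim_imp_Liminf[OF _ lim])
  also have "\<dots> \<le> liminf (\<lambda>n. \<integral>\<^sup>+\<omega>. ennreal (gauss (\<sigma> n) \<omega> * (cmod (FT x \<omega>))\<^sup>2) \<partial>lborel)"
    by (rule nn_integral_liminf) measurable
  also have "\<dots> \<le> limsup (\<lambda>n. \<integral>\<^sup>+\<omega>. ennreal (gauss (\<sigma> n) \<omega> * (cmod (FT x \<omega>))\<^sup>2) \<partial>lborel)"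
    by (rule Liminf_le_Limsup) simp
  also have "\<dots> \<le> ennreal (2 * pi * (l2_norm x)\<^sup>2)"
    using bound by (intro Limsup_bounded always_eventually) (auto simp: \<sigma>_def)
  finally have "(\<integral>\<^sup>+\<omega>. ennreal ((cmod (FT x \<omega>))\<^sup>2) \<partial>lborel) \<le> ennreal (2 * pi * (l2_norm x)\<^sup>2)" .
  then show "integrable lborel (\<lambda>\<omega>. (cmod (FT x \<omega>))\<^sup>2)"
    unfolding integrable_iff_bounded by (auto simp: le_less_trans)
qed

section \<open>Parseval's identity\<close>

text \<open>A dense class of signals for which the truncated transforms are eventually constant and the
  Gaussian means converge pointwise.\<close>

definition nice :: "signal \<Rightarrow> bool" where
  "nice u \<longleftrightarrow> u \<in> borel_measurable borel \<and> (\<exists>C. \<forall>t. \<bar>u t\<bar> \<le> C) \<and>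
     (\<exists>R. \<forall>t. R < \<bar>t\<bar> \<longrightarrow> u t = 0) \<and> (AE t in lborel. isCont u t)"

lemma bounded_support_integrable:
  fixes u :: "real \<Rightarrow> real"
  assumes [measurable]: "u \<in> borel_measurable borel" and C: "\<And>t. \<bar>u t\<bar> \<le> C"
    and R: "\<And>t. R < \<bar>t\<bar> \<Longrightarrow> u t = 0"
  shows "integrable lborel u"
proof (rule Bochner_Integration.integrable_bound)
  show "integrable lborel (\<lambda>t. C * indicator {-R..R} t :: real)"
    by (intro integrable_mult_right integrable_real_indicator) (simp_all add: emeasure_lborel_Icc_eq)
  show "AE t in lborel. norm (u t) \<le> norm (C * indicator {-R..R} t :: real)"
  proof (rule AE_I2)
    fix t
    show "norm (u t) \<le> norm (C * indicator {-R..R} t :: real)"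
    proof (cases "R < \<bar>t\<bar>")
      case False
      then have "t \<in> {-R..R}" by auto
      then show ?thesis using order_trans[OF C abs_ge_self, of t] by simp
    qed (simp add: R)
  qed
qed simp

lemma nice_measurable: "nice u \<Longrightarrow> u \<in> borel_measurable borel"
  by (simp add: nice_def)

lemma nice_integrable: "nice u \<Longrightarrow> integrable lborel u"
  unfolding nice_def using bounded_support_integrable[of u] by blast

lemma nice_L2:
  assumes "nice u"
  shows "u \<in> L2"
proof (rule L2I)
  obtain C R where C: "\<And>t. \<bar>u t\<bar> \<le> C" and R: "\<And>t. R < \<bar>t\<bar> \<Longrightarrow> u t = 0"
    using assms unfolding nice_def by blast
  show "integrable lborel (\<lambda>t. (u t)\<^sup>2)"
  proof (rule bounded_support_integrable[of _ "C\<^sup>2" R])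
    show "\<bar>(u t)\<^sup>2\<bar> \<le> C\<^sup>2" for t using power_mono[OF C[of t], of 2] by simp
  qed (use R nice_measurable[OF assms] in auto)
qed (rule nice_measurable[OF assms])

lemma AE_lborel_shift:
  fixes \<tau> :: real
  assumes "AE t in lborel. P t"
  shows "AE t in lborel. P (t + \<tau>)"
proof -
  have e: "distr lborel borel (\<lambda>t. t + \<tau>) = lborel"
    using lborel_distr_plus[of \<tau>] by (metis (no_types, lifting) add.commute ext)
  have "AE t in distr lborel borel (\<lambda>t. t + \<tau>). P t" unfolding e by (rule assms)
  moreover have "(\<lambda>t. t + \<tau>) \<in> lborel \<rightarrow>\<^sub>M borel" by simp
  ultimately show ?thesis by (metis AE_distrD)
qed

lemma nice_shift:
  assumes "nice u"
  shows "nice (\<lambda>t. u (t + \<tau>))"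
proof -
  obtain C R where C: "\<And>t. \<bar>u t\<bar> \<le> C" and R: "\<And>t. R < \<bar>t\<bar> \<Longrightarrow> u t = 0"
    using assms unfolding nice_def by blast
  have [measurable]: "u \<in> borel_measurable borel" by (rule nice_measurable[OF assms])
  have "AE t in lborel. isCont u (t + \<tau>)" using assms by (intro AE_lborel_shift) (simp add: nice_def)
  then have "AE t in lborel. isCont (\<lambda>t. u (t + \<tau>)) t"
    by eventually_elim (rule isCont_o2[of _ "\<lambda>t. t + \<tau>" u], auto)
  moreover have "\<forall>t. R + \<bar>\<tau>\<bar> < \<bar>t\<bar> \<longrightarrow> u (t + \<tau>) = 0" using R by auto
  ultimately show ?thesis unfolding nice_def using C by auto
qed

lemma nice_fourier_transform:
  assumes "nice u"
  shows "fourier_transform u (FT u)"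
proof -
  have [measurable]: "u \<in> borel_measurable borel" by (rule nice_measurable[OF assms])
  obtain R where R: "\<And>t. R < \<bar>t\<bar> \<Longrightarrow> u t = 0" using assms unfolding nice_def by blast
  \<comment> \<open>Once the window contains the support, the windowed transform no longer
    changes.\<close>
  have "(LINT t:{-T..T}|lborel. complex_of_real (u t) * cis (- (\<omega> * t))) = FT u \<omega>" if "R \<le> T" for T \<omega>
    unfolding set_lebesgue_integral_def FT_def
    using R that by (intro Bochner_Integration.integral_cong) (force simp: indicator_def)+
  then have "\<forall>\<^sub>F T in at_top. (\<integral>\<^sup>+\<omega>. ennreal ((cmod (FT u \<omega> -
      (LINT t:{-T..T}|lborel. complex_of_real (u t) * cis (- (\<omega> * t)))))\<^sup>2) \<partial>lborel) = 0"
    by (auto intro: eventually_mono[OF eventually_ge_at_top[of R]])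
  then have "((\<lambda>T. \<integral>\<^sup>+\<omega>. ennreal ((cmod (FT u \<omega> -
      (LINT t:{-T..T}|lborel. complex_of_real (u t) * cis (- (\<omega> * t)))))\<^sup>2) \<partial>lborel) \<longlongrightarrow> 0) at_top"
    by (rule tendsto_eventually)
  then show ?thesis unfolding fourier_transform_def
    using plancherel_integrable[OF nice_L2 nice_integrable] assms by simp
qed

lemma integrable_mult_of_squares:
  fixes f g :: "'a \<Rightarrow> complex"
  assumes "integrable M (\<lambda>x. (cmod (f x))\<^sup>2)" "integrable M (\<lambda>x. (cmod (g x))\<^sup>2)"
    and [measurable]: "f \<in> borel_measurable M" "g \<in> borel_measurable M"
  shows "integrable M (\<lambda>x. f x * g x)"
proof (rule Bochner_Integration.integrable_bound)
  show "integrable M (\<lambda>x. (cmod (f x))\<^sup>2 + (cmod (g x))\<^sup>2)"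
    using assms by simp
  have "cmod (f x * g x) \<le> (cmod (f x))\<^sup>2 + (cmod (g x))\<^sup>2" for x
  proof -
    have "2 * (cmod (f x) * cmod (g x)) \<le> (cmod (f x))\<^sup>2 + (cmod (g x))\<^sup>2"
      using sum_squares_bound[of "cmod (f x)" "cmod (g x)"] by simp
    moreover have "0 \<le> cmod (f x) * cmod (g x)" by simp
    ultimately show ?thesis unfolding norm_mult by linarith
  qed
  then show "AE x in M. norm (f x * g x) \<le> norm ((cmod (f x))\<^sup>2 + (cmod (g x))\<^sup>2)"
    by (intro AE_I2) simp
qed measurable

lemma cnj_measurable [measurable]: "cnj \<in> borel_measurable borel"
  by (intro borel_measurable_continuous_onI continuous_intros)

text \<open>The Gaussian means of the left side are evaluated in the limit twice: by dominated
  convergence over frequencies, and through \<open>gauss_parseval\<close> over times. Only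
  \<open>u\<close> is smoothed by the kernel, so \<open>x\<close> may be any integrable signal in
  \<open>L2\<close>.\<close>

lemma parseval:
  assumes x: "x \<in> L2" "integrable lborel x" and u: "nice u"
  shows "(LINT \<omega>|lborel. FT x \<omega> * cnj (FT u \<omega>)) = complex_of_real (2 * pi * ip x u)"
proof -
  define \<sigma> where "\<sigma> n = inverse (real (Suc n))" for n
  have \<sigma>: "0 < \<sigma> n" for n by (simp add: \<sigma>_def)
  have \<sigma>0: "\<sigma> \<longlonglongrightarrow> 0" unfolding \<sigma>_def by (rule LIMSEQ_inverse_real_of_nat)
  note uL = nice_L2[OF u] nice_integrable[OF u]
  have [measurable]: "x \<in> borel_measurable borel" "u \<in> borel_measurable borel"
    using x uL by (auto intro: L2_measurable)
  obtain C where C: "\<And>t. \<bar>u t\<bar> \<le> C" using u unfolding nice_def by blast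
  have C0: "0 \<le> C" using C[of 0] by simp
  have XU: "integrable lborel (\<lambda>\<omega>. FT x \<omega> * cnj (FT u \<omega>))"
    using plancherel_integrable[OF x] plancherel_integrable[OF uL]
    by (intro integrable_mult_of_squares) simp_all
  have "(\<lambda>n. LINT \<omega>|lborel. complex_of_real (gauss (\<sigma> n) \<omega>) * (FT x \<omega> * cnj (FT u \<omega>)))
      \<longlonglongrightarrow> (LINT \<omega>|lborel. FT x \<omega> * cnj (FT u \<omega>))"
  proof (rule integral_dominated_convergence)
    show "integrable lborel (\<lambda>\<omega>. norm (FT x \<omega> * cnj (FT u \<omega>)))" using XU by (rule integrable_norm)
    show "AE \<omega> in lborel. (\<lambda>n. complex_of_real (gauss (\<sigma> n) \<omega>) * (FT x \<omega> * cnj (FT u \<omega>)))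
        \<longlonglongrightarrow> FT x \<omega> * cnj (FT u \<omega>)"
    proof (rule AE_I2)
      fix \<omega>
      have "(\<lambda>n. gauss (\<sigma> n) \<omega>) \<longlonglongrightarrow> exp (- (0 * \<omega>)\<^sup>2 / 2)"
        unfolding gauss_def by (intro tendsto_intros \<sigma>0) simp
      then have "(\<lambda>n. complex_of_real (gauss (\<sigma> n) \<omega>)) \<longlonglongrightarrow> complex_of_real 1"
        by (intro tendsto_of_real) simp
      from tendsto_mult_right[OF this, of "FT x \<omega> * cnj (FT u \<omega>)"]
      show "(\<lambda>n. complex_of_real (gauss (\<sigma> n) \<omega>) * (FT x \<omega> * cnj (FT u \<omega>)))
          \<longlonglongrightarrow> FT x \<omega> * cnj (FT u \<omega>)" by simp
    qed
    show "AE \<omega> in lborel. norm (complex_of_real (gauss (\<sigma> n) \<omega>) * (FT x \<omega> * cnj (FT u \<omega>)))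
        \<le> norm (FT x \<omega> * cnj (FT u \<omega>))" for n
    proof (rule AE_I2)
      fix \<omega>
      have "gauss (\<sigma> n) \<omega> * norm (FT x \<omega> * cnj (FT u \<omega>)) \<le> 1 * norm (FT x \<omega> * cnj (FT u \<omega>))"
        using gauss_bounds[of "\<sigma> n" \<omega>] by (intro mult_right_mono) auto
      then show "norm (complex_of_real (gauss (\<sigma> n) \<omega>) * (FT x \<omega> * cnj (FT u \<omega>)))
          \<le> norm (FT x \<omega> * cnj (FT u \<omega>))"
        using gauss_bounds[of "\<sigma> n" \<omega>] by (simp add: norm_mult)
    qed
  qed measurable
  moreover have "(\<lambda>n. LINT \<omega>|lborel. complex_of_real (gauss (\<sigma> n) \<omega>) * (FT x \<omega> * cnj (FT u \<omega>)))
      \<longlonglongrightarrow> complex_of_real (2 * pi * ip x u)"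
  proof -
    \<comment> \<open>The Gaussian average of \<open>u\<close> around \<open>s\<close>. It is
      bounded by \<open>C\<close> and converges to \<open>u s\<close> at each continuity point,
      hence almost everywhere.\<close>
    define m where "m n s = (LINT z|lborel. u (s + \<sigma> n * z) * std_normal_density z)" for n s
    have mm [measurable]: "m n \<in> borel_measurable borel" for n
      unfolding m_def[abs_def] by measurable
    have ui: "integrable lborel (\<lambda>z. u (s + \<sigma> n * z) * std_normal_density z)" for n s
    proof (rule Bochner_Integration.integrable_bound)
      show "integrable lborel (\<lambda>z. C * std_normal_density z)" by simp
      show "AE z in lborel. norm (u (s + \<sigma> n * z) * std_normal_density z) \<le> norm (C * std_normal_density z)"
        using C C0 by (intro AE_I2) (auto simp: abs_mult intro!: mult_right_mono)
    qed measurable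
    have mC: "\<bar>m n s\<bar> \<le> C" for n s
    proof -
      have "\<bar>m n s\<bar> \<le> (LINT z|lborel. \<bar>u (s + \<sigma> n * z) * std_normal_density z\<bar>)"
        unfolding m_def by (rule integral_abs_bound)
      also have "\<dots> \<le> (LINT z|lborel. C * std_normal_density z)"
        using C ui by (intro integral_mono integrable_abs) (auto simp: abs_mult intro!: mult_right_mono)
      finally show ?thesis by simp
    qed
    have lim: "(\<lambda>n. m n s) \<longlonglongrightarrow> u s" if "isCont u s" for s
    proof -
      have "(\<lambda>n. m n s) \<longlonglongrightarrow> (LINT z|lborel. u s * std_normal_density z)"
        unfolding m_def
      proof (rule integral_dominated_convergence)
        show "integrable lborel (\<lambda>z. C * std_normal_density z)" by simp
        show "AE z in lborel. (\<lambda>n. u (s + \<sigma> n * z) * std_normal_density z) \<longlonglongrightarrow> u s * std_normal_density z"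
        proof (rule AE_I2)
          fix z
          have "(\<lambda>n. s + \<sigma> n * z) \<longlonglongrightarrow> s + 0 * z" by (intro tendsto_intros \<sigma>0)
          then have "(\<lambda>n. u (s + \<sigma> n * z)) \<longlonglongrightarrow> u s"
            using isCont_tendsto_compose[OF that] by simp
          then show "(\<lambda>n. u (s + \<sigma> n * z) * std_normal_density z) \<longlonglongrightarrow> u s * std_normal_density z"
            by (rule tendsto_mult_right)
        qed
        show "AE z in lborel. norm (u (s + \<sigma> n * z) * std_normal_density z) \<le> C * std_normal_density z" for n
          using C by (intro AE_I2) (auto simp: abs_mult intro!: mult_right_mono)
      qed measurable
      then show ?thesis by simp
    qed
    have "(LINT (s, t)|(lborel \<Otimes>\<^sub>M lborel). x s * u t * kern (\<sigma> n) (t - s)) = (LINT s|lborel. x s * m n s)" for n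
    proof -
      have I: "integrable (lborel \<Otimes>\<^sub>M lborel) (\<lambda>(s, t). x s * u t * kern (\<sigma> n) (t - s))"
      proof (rule lborel_pair.Fubini_integrable)
        have *: "integrable lborel (\<lambda>t. u t * kern (\<sigma> n) (t - s))" for s
          unfolding kern_average(2)[OF \<sigma>] by (rule ui)
        show "AE s in lborel. integrable lborel (\<lambda>t. case (s, t) of (s, t) \<Rightarrow> x s * u t * kern (\<sigma> n) (t - s))"
          using * by (simp add: mult.assoc)
        show "integrable lborel (\<lambda>s. LINT t|lborel. norm (case (s, t) of (s, t) \<Rightarrow> x s * u t * kern (\<sigma> n) (t - s)))"
        proof (rule Bochner_Integration.integrable_bound)
          show "integrable lborel (\<lambda>s. C * x s)" using x by simp
          have "(LINT t|lborel. norm (case (s, t) of (s, t) \<Rightarrow> x s * u t * kern (\<sigma> n) (t - s))) \<le> \<bar>C * x s\<bar>" for s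
          proof -
            have "(LINT t|lborel. norm (case (s, t) of (s, t) \<Rightarrow> x s * u t * kern (\<sigma> n) (t - s)))
                = \<bar>x s\<bar> * (LINT t|lborel. \<bar>u t * kern (\<sigma> n) (t - s)\<bar>)"
              by (simp add: abs_mult mult.assoc)
            also have "\<dots> \<le> \<bar>x s\<bar> * (LINT t|lborel. C * kern (\<sigma> n) (t - s))"
              using C kern_nonneg[OF \<sigma>] kern_integral(2)[OF \<sigma>] *
              by (intro mult_left_mono integral_mono integrable_abs)
                (auto simp: abs_mult intro!: mult_right_mono)
            also have "\<dots> = \<bar>C * x s\<bar>" using kern_integral[OF \<sigma>] C0 by (simp add: abs_mult)
            finally show ?thesis .
          qed
          moreover have "0 \<le> (LINT t|lborel. norm (case (s, t) of (s, t) \<Rightarrow> x s * u t * kern (\<sigma> n) (t - s)))" for s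
            by (rule Bochner_Integration.integral_nonneg) simp
          ultimately show "AE s in lborel. norm (LINT t|lborel. norm (case (s, t) of (s, t) \<Rightarrow> x s * u t * kern (\<sigma> n) (t - s)))
              \<le> norm (C * x s)" by simp
        qed measurable
      qed measurable
      have "(LINT s|lborel. LINT t|lborel. x s * u t * kern (\<sigma> n) (t - s)) = (LINT s|lborel. x s * m n s)"
        by (simp add: mult.assoc kern_average(1)[OF \<sigma>] m_def)
      then show ?thesis using lborel_pair.integral_fst[OF I] by simp
    qed
    moreover have "(\<lambda>n. LINT s|lborel. x s * m n s) \<longlonglongrightarrow> ip x u"
      unfolding ip_def
    proof (rule integral_dominated_convergence)
      show "integrable lborel (\<lambda>s. C * \<bar>x s\<bar>)" using x by simp
      have "AE s in lborel. isCont u s" using u by (simp add: nice_def)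
      then show "AE s in lborel. (\<lambda>n. x s * m n s) \<longlonglongrightarrow> x s * u s"
        by eventually_elim (intro tendsto_mult tendsto_const lim)
      show "AE s in lborel. norm (x s * m n s) \<le> C * \<bar>x s\<bar>" for n
        using mult_right_mono[OF mC, of "\<bar>x s\<bar>" n s for s]
        by (intro AE_I2) (simp add: abs_mult mult.commute[of "\<bar>x _\<bar>"])
    qed measurable
    ultimately show ?thesis
      unfolding gauss_parseval[OF x(2) uL(2) \<sigma>] by (intro tendsto_of_real tendsto_mult tendsto_const) simp
  qed
  ultimately show ?thesis by (rule LIMSEQ_unique)
qed

lemma nice_plancherel:
  assumes "nice u"
  shows "(LINT \<omega>|lborel. (cmod (FT u \<omega>))\<^sup>2) = 2 * pi * (l2_norm u)\<^sup>2"
proof -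
  have "complex_of_real (LINT \<omega>|lborel. (cmod (FT u \<omega>))\<^sup>2) = (LINT \<omega>|lborel. FT u \<omega> * cnj (FT u \<omega>))"
    by (simp only: integral_complex_of_real[symmetric] complex_norm_square)
  also have "\<dots> = complex_of_real (2 * pi * (l2_norm u)\<^sup>2)"
    unfolding parseval[OF nice_L2[OF assms] nice_integrable[OF assms] assms] ip_self ..
  finally show ?thesis by (simp only: of_real_eq_iff)
qed

section \<open>The frequency condition\<close>

text \<open>Fubini with both \<open>k\<close> and \<open>W\<close> integrable; the oscillating
  factor has modulus 1.\<close>

lemma (in delays) transform_exchange:
  fixes W :: "real \<Rightarrow> complex"
  assumes W: "integrable lborel W"
  shows "integrable lborel (\<lambda>\<omega>. W \<omega> * (LINT x|K. complex_of_real (k x) * cis (- (\<omega> * l x))))"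
    and "(LINT x|K. complex_of_real (k x) * (LINT \<omega>|lborel. W \<omega> * cis (- (\<omega> * l x)))) =
      (LINT \<omega>|lborel. W \<omega> * (LINT x|K. complex_of_real (k x) * cis (- (\<omega> * l x))))"
proof -
  have [measurable]: "W \<in> borel_measurable borel" using W by auto
  let ?f = "\<lambda>x \<omega>. complex_of_real (k x) * (W \<omega> * cis (- (\<omega> * l x)))"
  have I: "integrable (K \<Otimes>\<^sub>M lborel) (case_prod ?f)"
  proof (rule Fubini_integrable)
    show "case_prod ?f \<in> borel_measurable (K \<Otimes>\<^sub>M lborel)" by measurable
    show "integrable K (\<lambda>x. LINT \<omega>|lborel. norm (case_prod ?f (x, \<omega>)))"
      using k by (simp add: norm_mult)
    show "AE x in K. integrable lborel (\<lambda>\<omega>. case_prod ?f (x, \<omega>))"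
      using W by (intro AE_I2) (simp add: integrable_cis_mult)
  qed
  have e: "(LINT x|K. ?f x \<omega>) = W \<omega> * (LINT x|K. complex_of_real (k x) * cis (- (\<omega> * l x)))" for \<omega>
  proof -
    have "(\<lambda>x. ?f x \<omega>) = (\<lambda>x. W \<omega> * (complex_of_real (k x) * cis (- (\<omega> * l x))))"
      by (simp add: mult_ac)
    then show ?thesis by (simp only: integral_mult_right_zero)
  qed
  show "integrable lborel (\<lambda>\<omega>. W \<omega> * (LINT x|K. complex_of_real (k x) * cis (- (\<omega> * l x))))"
    using integrable_snd[OF I] unfolding e .
  show "(LINT x|K. complex_of_real (k x) * (LINT \<omega>|lborel. W \<omega> * cis (- (\<omega> * l x)))) =
      (LINT \<omega>|lborel. W \<omega> * (LINT x|K. complex_of_real (k x) * cis (- (\<omega> * l x))))"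
    using Fubini_integral[OF I] unfolding e by simp
qed

text \<open>Evaluating \<delta> - h against \<open>c\<close> amounts to integrating its transform
  against \<open>W\<close>. In the application \<open>c\<close> is a multiple of the correlation of
  \<open>G u\<close> with \<open>u\<close>, and \<open>W\<close> is their cross-spectrum.\<close>

lemma multiplier_transform_exchange:
  assumes h: "h \<in> HH" and W: "integrable lborel W"
    and c: "\<And>\<tau>. complex_of_real (c \<tau>) = (LINT \<omega>|lborel. W \<omega> * cis (- (\<omega> * \<tau>)))"
    and sc: "summable (\<lambda>i. \<bar>weight h i * c (loc h i)\<bar>)"
  shows "integrable lborel (\<lambda>\<omega>. W \<omega> * multiplier_freq h \<omega>)"
    and "complex_of_real (c 0 - ((\<Sum>i. weight h i * c (loc h i)) + (LINT \<tau>|lborel. dens h \<tau> * c \<tau>))) =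
      (LINT \<omega>|lborel. W \<omega> * multiplier_freq h \<omega>)"
proof -
  interpret a: delays "count_space UNIV" "weight h" "loc h" by (rule HH_atoms[OF h])
  interpret d: delays lborel "dens h" "\<lambda>\<tau>. \<tau>" by (rule HH_dens[OF h])
  let ?a = "\<lambda>\<omega>. LINT i|count_space UNIV. complex_of_real (weight h i) * cis (- (\<omega> * loc h i))"
  let ?d = "\<lambda>\<omega>. LINT \<tau>|lborel. complex_of_real (dens h \<tau>) * cis (- (\<omega> * \<tau>))"
  have "integrable (count_space UNIV) (\<lambda>i. complex_of_real (weight h i) * cis (- (\<omega> * loc h i)))" for \<omega>
    using a.k by (simp add: integrable_count_space_nat_iff norm_mult)
  then have M: "multiplier_freq h \<omega> = 1 - (?a \<omega> + ?d \<omega>)" for \<omega>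
    by (simp add: multiplier_freq_def integral_count_space_nat)
  note I = a.transform_exchange(1)[OF W] d.transform_exchange(1)[OF W]
  show "integrable lborel (\<lambda>\<omega>. W \<omega> * multiplier_freq h \<omega>)"
    unfolding M right_diff_distrib distrib_left using W I by simp
  have A: "integrable (count_space UNIV) (\<lambda>i. weight h i * c (loc h i))"
    using sc by (simp add: integrable_count_space_nat_iff)
  have "complex_of_real (\<Sum>i. weight h i * c (loc h i)) =
      (LINT i|count_space UNIV. complex_of_real (weight h i) * (LINT \<omega>|lborel. W \<omega> * cis (- (\<omega> * loc h i))))"
    unfolding integral_count_space_nat[OF A, symmetric] c[symmetric] of_real_mult[symmetric]
      integral_complex_of_real ..
  also have "\<dots> = (LINT \<omega>|lborel. W \<omega> * ?a \<omega>)" by (rule a.transform_exchange(2)[OF W])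
  finally have 1: "complex_of_real (\<Sum>i. weight h i * c (loc h i)) = (LINT \<omega>|lborel. W \<omega> * ?a \<omega>)" .
  have "complex_of_real (LINT \<tau>|lborel. dens h \<tau> * c \<tau>) =
      (LINT \<tau>|lborel. complex_of_real (dens h \<tau>) * (LINT \<omega>|lborel. W \<omega> * cis (- (\<omega> * \<tau>))))"
    unfolding c[symmetric] of_real_mult[symmetric] integral_complex_of_real ..
  also have "\<dots> = (LINT \<omega>|lborel. W \<omega> * ?d \<omega>)" by (rule d.transform_exchange(2)[OF W])
  finally have 2: "complex_of_real (LINT \<tau>|lborel. dens h \<tau> * c \<tau>) = (LINT \<omega>|lborel. W \<omega> * ?d \<omega>)" .
  have 0: "complex_of_real (c 0) = (LINT \<omega>|lborel. W \<omega>)" by (simp add: c)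
  show "complex_of_real (c 0 - ((\<Sum>i. weight h i * c (loc h i)) + (LINT \<tau>|lborel. dens h \<tau> * c \<tau>))) =
      (LINT \<omega>|lborel. W \<omega> * multiplier_freq h \<omega>)"
    unfolding M right_diff_distrib distrib_left using W I by (simp add: 0 1 2)
qed

lemma indicator_window_L2: "(indicator {-R..R} :: signal) \<in> L2"
proof (rule L2I)
  have "(\<lambda>t. (indicator {-R..R} t :: real)\<^sup>2) = indicator {-R..R}"
    by (auto simp: indicator_def)
  then show "integrable lborel (\<lambda>t. (indicator {-R..R} t :: real)\<^sup>2)"
    by (simp add: emeasure_lborel_Icc_eq)
qed simp

text \<open>Extends \<open>parseval\<close> to signals whose transform exists only as a mean-square
  limit, such as \<open>G u\<close>: the identity holds for the windowed signals, and both sides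
  pass to the limit.\<close>

lemma corr_fourier:
  assumes x: "x \<in> L2" and V: "fourier_transform x V" and u: "nice u"
  shows "integrable lborel (\<lambda>\<omega>. V \<omega> * cnj (FT u \<omega>))"
    and "complex_of_real (2 * pi * corr x u \<tau>) = (LINT \<omega>|lborel. V \<omega> * cnj (FT u \<omega>) * cis (- (\<omega> * \<tau>)))"
proof -
  \<comment> \<open>Correlating at lag \<open>\<tau>\<close> is pairing with a translate of
    \<open>u\<close>, and translation multiplies the transform by
    \<open>cis (\<omega> * \<tau>)\<close>.\<close>
  define U where "U = FT (\<lambda>t. u (t + \<tau>))"
  note u' = nice_shift[OF u, of \<tau>]
  note uL = nice_L2[OF u] nice_integrable[OF u]
  have [measurable]: "x \<in> borel_measurable borel" "u \<in> borel_measurable borel" "V \<in> borel_measurable borel"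
    using x uL V by (auto intro: L2_measurable simp: fourier_transform_def)
  have U: "U \<omega> = cis (\<omega> * \<tau>) * FT u \<omega>" for \<omega> by (simp add: U_def FT_shift)
  have [measurable]: "U \<in> borel_measurable borel" unfolding U_def by measurable
  have U2: "integrable lborel (\<lambda>\<omega>. (cmod (U \<omega>))\<^sup>2)"
    unfolding U_def by (rule plancherel_integrable[OF nice_L2[OF u'] nice_integrable[OF u']])
  have V2: "integrable lborel (\<lambda>\<omega>. (cmod (V \<omega>))\<^sup>2)" using V by (simp add: fourier_transform_def)
  show "integrable lborel (\<lambda>\<omega>. V \<omega> * cnj (FT u \<omega>))"
    using V2 plancherel_integrable[OF uL] by (intro integrable_mult_of_squares) simp_all
  have VU: "integrable lborel (\<lambda>\<omega>. V \<omega> * cnj (U \<omega>))"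
    using V2 U2 by (intro integrable_mult_of_squares) simp_all
  define xn where "xn n = (\<lambda>t. indicator {- real n..real n} t * x t)" for n
  have xn_m [measurable]: "xn n \<in> borel_measurable borel" for n unfolding xn_def by measurable
  have xn2: "xn n \<in> L2" for n
    by (rule L2_dominated[OF x, of _ 1]) (auto simp: xn_def indicator_def)
  have xn1: "integrable lborel (xn n)" for n
    unfolding xn_def by (rule L2_integrable_mult[OF indicator_window_L2 x])
  have xnP: "(LINT \<omega>|lborel. FT (xn n) \<omega> * cnj (U \<omega>)) = complex_of_real (2 * pi * ip (xn n) (\<lambda>t. u (t + \<tau>)))" for n
    unfolding U_def by (rule parseval[OF xn2 xn1 u'])
  have FTxn: "FT (xn n) \<omega> = (LINT t:{- real n..real n}|lborel. complex_of_real (x t) * cis (- (\<omega> * t)))" for n \<omega>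
    unfolding FT_def set_lebesgue_integral_def xn_def
    by (intro Bochner_Integration.integral_cong) (auto simp: indicator_def)
  have "((\<lambda>T. \<integral>\<^sup>+\<omega>. ennreal ((cmod (V \<omega> -
      (LINT t:{-T..T}|lborel. complex_of_real (x t) * cis (- (\<omega> * t)))))\<^sup>2) \<partial>lborel) \<longlongrightarrow> 0) at_top"
    using V by (simp only: fourier_transform_def)
  from filterlim_compose[OF this filterlim_real_sequentially]
  have "(\<lambda>n. \<integral>\<^sup>+\<omega>. ennreal ((cmod (V \<omega> - FT (xn n) \<omega>))\<^sup>2) \<partial>lborel) \<longlonglongrightarrow> 0"
    unfolding FTxn .
  then have "(\<lambda>n. (\<integral>\<^sup>+\<omega>. ennreal ((cmod (V \<omega> - FT (xn n) \<omega>))\<^sup>2) \<partial>lborel) *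
      (\<integral>\<^sup>+\<omega>. ennreal ((cmod (U \<omega>))\<^sup>2) \<partial>lborel)) \<longlonglongrightarrow> 0 * (\<integral>\<^sup>+\<omega>. ennreal ((cmod (U \<omega>))\<^sup>2) \<partial>lborel)"
    using U2 by (intro tendsto_mult_ennreal tendsto_const) (auto simp: integrable_iff_bounded)
  then have lim0: "(\<lambda>n. (\<integral>\<^sup>+\<omega>. ennreal ((cmod (V \<omega> - FT (xn n) \<omega>))\<^sup>2) \<partial>lborel) *
      (\<integral>\<^sup>+\<omega>. ennreal ((cmod (U \<omega>))\<^sup>2) \<partial>lborel)) \<longlonglongrightarrow> 0" by simp
  \<comment> \<open>By Cauchy-Schwarz its square is at most the mean-square error of the windowed
    transforms times the energy of \<open>U\<close>; the first factor tends to 0 by the definition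
    of \<open>fourier_transform\<close>.\<close>
  define e where "e n = norm ((LINT \<omega>|lborel. FT (xn n) \<omega> * cnj (U \<omega>)) - (LINT \<omega>|lborel. V \<omega> * cnj (U \<omega>)))" for n
  have "ennreal ((e n)\<^sup>2) \<le> (\<integral>\<^sup>+\<omega>. ennreal ((cmod (V \<omega> - FT (xn n) \<omega>))\<^sup>2) \<partial>lborel) *
      (\<integral>\<^sup>+\<omega>. ennreal ((cmod (U \<omega>))\<^sup>2) \<partial>lborel)" for n
  proof -
    have XU: "integrable lborel (\<lambda>\<omega>. FT (xn n) \<omega> * cnj (U \<omega>))"
      using plancherel_integrable[OF xn2 xn1] U2 by (intro integrable_mult_of_squares) simp_all
    have "e n = norm (LINT \<omega>|lborel. (FT (xn n) \<omega> - V \<omega>) * cnj (U \<omega>))"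
      unfolding e_def left_diff_distrib using XU VU by simp
    then have "ennreal (e n) \<le> (\<integral>\<^sup>+\<omega>. ennreal (norm ((FT (xn n) \<omega> - V \<omega>) * cnj (U \<omega>))) \<partial>lborel)"
      using integral_norm_bound_ennreal[of lborel "\<lambda>\<omega>. (FT (xn n) \<omega> - V \<omega>) * cnj (U \<omega>)"] XU VU
      by (simp add: left_diff_distrib)
    also have "\<dots> = (\<integral>\<^sup>+\<omega>. ennreal (cmod (V \<omega> - FT (xn n) \<omega>)) * ennreal (cmod (U \<omega>)) \<partial>lborel)"
      by (simp add: norm_mult ennreal_mult norm_minus_commute)
    finally have "(ennreal (e n))\<^sup>2 \<le> (\<integral>\<^sup>+\<omega>. ennreal (cmod (V \<omega> - FT (xn n) \<omega>)) * ennreal (cmod (U \<omega>)) \<partial>lborel)\<^sup>2"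
      by (intro power_mono) auto
    also have "\<dots> \<le> (\<integral>\<^sup>+\<omega>. (ennreal (cmod (V \<omega> - FT (xn n) \<omega>)))\<^sup>2 \<partial>lborel) *
        (\<integral>\<^sup>+\<omega>. (ennreal (cmod (U \<omega>)))\<^sup>2 \<partial>lborel)"
      by (rule Cauchy_Schwarz_nn_integral) measurable
    finally show ?thesis by (simp add: ennreal_power e_def)
  qed
  then have "(\<lambda>n. ennreal ((e n)\<^sup>2)) \<longlonglongrightarrow> 0"
    by (intro tendsto_sandwich[OF _ _ tendsto_const lim0]) (auto intro: always_eventually)
  then have "(\<lambda>n. ennreal ((e n)\<^sup>2)) \<longlonglongrightarrow> ennreal 0" by simp
  then have "(\<lambda>n. (e n)\<^sup>2) \<longlonglongrightarrow> 0" by (subst (asm) tendsto_ennreal_iff) auto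
  moreover have "sqrt ((e n)\<^sup>2) = e n" for n by (simp add: e_def)
  ultimately have "e \<longlonglongrightarrow> 0" using tendsto_real_sqrt[of "\<lambda>n. (e n)\<^sup>2" 0 sequentially] by simp
  then have "(\<lambda>n. LINT \<omega>|lborel. FT (xn n) \<omega> * cnj (U \<omega>)) \<longlonglongrightarrow> (LINT \<omega>|lborel. V \<omega> * cnj (U \<omega>))"
    unfolding e_def by (rule LIM_zero_cancel[OF tendsto_norm_zero_cancel])
  moreover have "(\<lambda>n. LINT \<omega>|lborel. FT (xn n) \<omega> * cnj (U \<omega>)) \<longlonglongrightarrow> complex_of_real (2 * pi * corr x u \<tau>)"
  proof -
    have xu: "integrable lborel (\<lambda>t. x t * u (t + \<tau>))"
      by (rule L2_integrable_mult[OF x nice_L2[OF u']])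
    have "(\<lambda>n. ip (xn n) (\<lambda>t. u (t + \<tau>))) \<longlonglongrightarrow> (LINT t|lborel. x t * u (t + \<tau>))"
      unfolding ip_def
    proof (rule integral_dominated_convergence)
      show "integrable lborel (\<lambda>t. norm (x t * u (t + \<tau>)))" using xu by (rule integrable_norm)
      show "AE t in lborel. (\<lambda>n. xn n t * u (t + \<tau>)) \<longlonglongrightarrow> x t * u (t + \<tau>)"
      proof (rule AE_I2)
        fix t
        obtain N where "\<bar>t\<bar> \<le> real N" using real_arch_simple by blast
        then have "xn n t * u (t + \<tau>) = x t * u (t + \<tau>)" if "N \<le> n" for n
          using that by (auto simp: xn_def indicator_def)
        then show "(\<lambda>n. xn n t * u (t + \<tau>)) \<longlonglongrightarrow> x t * u (t + \<tau>)"
          by (intro tendsto_eventually) (auto simp: eventually_sequentially)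
      qed
      show "AE t in lborel. norm (xn n t * u (t + \<tau>)) \<le> norm (x t * u (t + \<tau>))" for n
        by (intro AE_I2) (auto simp: xn_def indicator_def)
    qed measurable
    moreover have "(LINT t|lborel. x t * u (t + \<tau>)) = corr x u \<tau>"
      unfolding corr_def by (subst lborel_integral_real_affine[of 1 _ "-\<tau>"]) (simp_all add: algebra_simps)
    ultimately show ?thesis
      unfolding xnP by (intro tendsto_of_real tendsto_mult tendsto_const) simp
  qed
  ultimately have "(LINT \<omega>|lborel. V \<omega> * cnj (U \<omega>)) = complex_of_real (2 * pi * corr x u \<tau>)"
    by (rule LIMSEQ_unique)
  from this[symmetric] show "complex_of_real (2 * pi * corr x u \<tau>) = (LINT \<omega>|lborel. V \<omega> * cnj (FT u \<omega>) * cis (- (\<omega> * \<tau>)))"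
    by (simp add: U cis_cnj mult_ac)
qed

text \<open>In the frequency domain the pairing is the integral of the squared modulus of
  \<open>FT u\<close> times the real part of \<open>M G\<close>. The pointwise lower bound and
  \<open>nice_plancherel\<close> finish; the factors \<open>2 * pi\<close> cancel.\<close>

lemma frequency_positive_nice:
  assumes h: "h \<in> HH" and G: "frequency_response G Ghat" and Gu: "G u \<in> L2" and u: "nice u"
    and pos: "\<And>\<omega>. \<epsilon> \<le> Re (multiplier_freq h \<omega> * Ghat \<omega>)"
  shows "\<epsilon> * (l2_norm u)\<^sup>2 \<le> ip (multiplier h (G u)) u"
proof -
  have uL: "u \<in> L2" by (rule nice_L2[OF u])
  have V: "fourier_transform (G u) (\<lambda>\<omega>. Ghat \<omega> * FT u \<omega>)"
    using G uL nice_fourier_transform[OF u] unfolding frequency_response_def by blast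
  let ?W = "\<lambda>\<omega>. Ghat \<omega> * FT u \<omega> * cnj (FT u \<omega>)"
  let ?c = "\<lambda>\<tau>. 2 * pi * corr (G u) u \<tau>"
  have W: "integrable lborel ?W" by (rule corr_fourier(1)[OF Gu V u])
  have c: "complex_of_real (?c \<tau>) = (LINT \<omega>|lborel. ?W \<omega> * cis (- (\<omega> * \<tau>)))" for \<tau>
    by (rule corr_fourier(2)[OF Gu V u])
  have sc: "summable (\<lambda>i. \<bar>weight h i * ?c (loc h i)\<bar>)"
    using summable_mult[OF corr_summable[OF h Gu uL], of "2 * pi"] by (simp add: abs_mult mult_ac)
  have "2 * pi * ip (multiplier h (G u)) u =
      ?c 0 - ((\<Sum>i. weight h i * ?c (loc h i)) + (LINT \<tau>|lborel. dens h \<tau> * ?c \<tau>))"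
  proof -
    have "(\<Sum>i. weight h i * ?c (loc h i)) = 2 * pi * (\<Sum>i. weight h i * corr (G u) u (loc h i))"
      using suminf_mult[OF summable_rabs_cancel[OF corr_summable[OF h Gu uL]], of "2 * pi"]
      by (simp add: mult_ac)
    moreover have "(LINT \<tau>|lborel. dens h \<tau> * ?c \<tau>) = 2 * pi * (LINT \<tau>|lborel. dens h \<tau> * corr (G u) u \<tau>)"
      unfolding integral_mult_right_zero[symmetric]
      by (rule Bochner_Integration.integral_cong) (simp_all add: mult_ac)
    ultimately show ?thesis
      by (simp add: ip_multiplier[OF h Gu uL] ip_conv[OF h Gu uL] corr_0 algebra_simps)
  qed
  then have "complex_of_real (2 * pi * ip (multiplier h (G u)) u) = (LINT \<omega>|lborel. ?W \<omega> * multiplier_freq h \<omega>)"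
    using multiplier_transform_exchange(2)[OF h W c sc] by simp
  then have eq: "2 * pi * ip (multiplier h (G u)) u = (LINT \<omega>|lborel. Re (?W \<omega> * multiplier_freq h \<omega>))"
    using multiplier_transform_exchange(1)[OF h W c sc] by (metis integral_Re Re_complex_of_real)
  have Re_of_real_mult: "Re (complex_of_real r * z) = r * Re z" for r z by simp
  have "?W \<omega> * multiplier_freq h \<omega> = complex_of_real ((cmod (FT u \<omega>))\<^sup>2) * (multiplier_freq h \<omega> * Ghat \<omega>)" for \<omega>
    unfolding complex_norm_square by (simp add: mult_ac)
  then have Re: "Re (?W \<omega> * multiplier_freq h \<omega>) = (cmod (FT u \<omega>))\<^sup>2 * Re (multiplier_freq h \<omega> * Ghat \<omega>)" for \<omega>
    by (simp only: Re_of_real_mult)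
  have "2 * pi * (\<epsilon> * (l2_norm u)\<^sup>2) = (LINT \<omega>|lborel. (cmod (FT u \<omega>))\<^sup>2 * \<epsilon>)"
    using nice_plancherel[OF u] by simp
  also have "\<dots> \<le> (LINT \<omega>|lborel. Re (?W \<omega> * multiplier_freq h \<omega>))"
  proof (rule integral_mono)
    show "integrable lborel (\<lambda>\<omega>. (cmod (FT u \<omega>))\<^sup>2 * \<epsilon>)"
      using plancherel_integrable[OF uL nice_integrable[OF u]] by simp
    show "integrable lborel (\<lambda>\<omega>. Re (?W \<omega> * multiplier_freq h \<omega>))"
      by (rule integrable_Re[OF multiplier_transform_exchange(1)[OF h W c sc]])
    show "(cmod (FT u \<omega>))\<^sup>2 * \<epsilon> \<le> Re (?W \<omega> * multiplier_freq h \<omega>)" for \<omega>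
      unfolding Re using pos by (intro mult_left_mono) auto
  qed
  also have "\<dots> = 2 * pi * ip (multiplier h (G u)) u" using eq by simp
  finally show ?thesis using pi_gt_zero by simp
qed

section \<open>Density\<close>

lemma l2_norm_tendsto_0:
  assumes x: "x \<in> L2" and w: "w \<in> L2" and [measurable]: "\<And>n. xn n \<in> borel_measurable borel"
    and bound: "\<And>n. AE t in lborel. \<bar>xn n t\<bar> \<le> \<bar>w t\<bar>"
    and lim: "AE t in lborel. (\<lambda>n. xn n t) \<longlonglongrightarrow> x t"
  shows "(\<lambda>n. l2_norm (\<lambda>t. x t - xn n t)) \<longlonglongrightarrow> 0"
proof -
  have [measurable]: "x \<in> borel_measurable borel" by (rule L2_measurable[OF x])
  have "(\<lambda>n. LINT t|lborel. (x t - xn n t)\<^sup>2) \<longlonglongrightarrow> (LINT t|(lborel :: real measure). 0)"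
  proof (rule integral_dominated_convergence)
    show "integrable lborel (\<lambda>t. (\<bar>x t\<bar> + \<bar>w t\<bar>)\<^sup>2)"
      by (intro L2_square L2_add L2_abs x w)
    show "AE t in lborel. (\<lambda>n. (x t - xn n t)\<^sup>2) \<longlonglongrightarrow> 0"
      using lim
    proof eventually_elim
      case (elim t)
      then have "(\<lambda>n. (x t - xn n t)\<^sup>2) \<longlonglongrightarrow> (x t - x t)\<^sup>2" by (intro tendsto_intros)
      then show ?case by simp
    qed
    show "AE t in lborel. norm ((x t - xn n t)\<^sup>2) \<le> (\<bar>x t\<bar> + \<bar>w t\<bar>)\<^sup>2" for n
      using bound[of n]
    proof eventually_elim
      case (elim t)
      then have "\<bar>x t - xn n t\<bar> \<le> \<bar>x t\<bar> + \<bar>w t\<bar>" by linarith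
      then have "\<bar>x t - xn n t\<bar>\<^sup>2 \<le> (\<bar>x t\<bar> + \<bar>w t\<bar>)\<^sup>2" by (rule power_mono) simp
      then show ?case by simp
    qed
  qed simp_all
  then have "(\<lambda>n. sqrt (LINT t|lborel. (x t - xn n t)\<^sup>2)) \<longlonglongrightarrow> sqrt 0"
    by (intro tendsto_real_sqrt) simp
  then show ?thesis by (simp add: l2_norm_def)
qed

definition clamp :: "real \<Rightarrow> real \<Rightarrow> real" where
  "clamp N x = max (- N) (min N x)"

lemma clamp_bounds: "0 \<le> N \<Longrightarrow> \<bar>clamp N x\<bar> \<le> N" "0 \<le> N \<Longrightarrow> \<bar>clamp N x\<bar> \<le> \<bar>x\<bar>"
  by (auto simp: clamp_def max_def min_def)

lemma clamp_id: "\<bar>x\<bar> \<le> N \<Longrightarrow> clamp N x = x"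
  by (auto simp: clamp_def)

lemma clamp_tendsto: "(f \<longlongrightarrow> l) F \<Longrightarrow> ((\<lambda>x. clamp N (f x)) \<longlongrightarrow> clamp N l) F"
  unfolding clamp_def by (intro tendsto_max tendsto_min tendsto_const)

lemma clamp_measurable [measurable]: "clamp N \<in> borel_measurable borel"
  unfolding clamp_def[abs_def] by measurable

lemma continuous_clamp: "continuous_on A f \<Longrightarrow> continuous_on A (\<lambda>x. clamp N (f x))"
  unfolding clamp_def by (intro continuous_intros)

text \<open>A sharp window introduces discontinuities at the two endpoints at most.\<close>

lemma nice_window:
  assumes "continuous_on UNIV g" "0 \<le> N"
  shows "nice (\<lambda>t. indicator {-R..R} t * clamp N (g t))"
proof -
  have [measurable]: "g \<in> borel_measurable borel"
    using assms(1) by (rule borel_measurable_continuous_onI)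
  let ?f = "\<lambda>t. indicator {-R..R} t * clamp N (g t) :: real"
  have cg: "isCont (\<lambda>t. clamp N (g t)) t" for t
    using continuous_clamp[OF assms(1)] by (simp add: continuous_on_eq_continuous_at)
  have cont: "isCont ?f t" if "t \<noteq> R" "t \<noteq> -R" for t
  proof (cases "t \<in> {-R..R}")
    case True
    then have "\<forall>\<^sub>F s in nhds t. s \<in> {-R<..<R}"
      using that by (intro eventually_nhds_in_open) auto
    then have "\<forall>\<^sub>F s in nhds t. ?f s = clamp N (g s)" by eventually_elim auto
    then show ?thesis using cg[of t] isCont_cong by fastforce
  next
    case False
    then have "\<forall>\<^sub>F s in nhds t. s \<in> - {-R..R}" by (intro eventually_nhds_in_open) auto
    then have "\<forall>\<^sub>F s in nhds t. ?f s = 0" by eventually_elim auto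
    then show ?thesis using isCont_cong[of ?f "\<lambda>_. 0" t] by simp
  qed
  have "AE t in lborel. t \<noteq> R" "AE t in lborel. t \<noteq> -R" by (rule AE_lborel_singleton)+
  then have "AE t in lborel. isCont ?f t" by eventually_elim (rule cont)
  moreover have "\<bar>?f t\<bar> \<le> N" for t
    using clamp_bounds(1)[OF assms(2), of "g t"] assms(2) by (simp add: indicator_def)
  moreover have "R < \<bar>t\<bar> \<Longrightarrow> ?f t = 0" for t by (auto simp: indicator_def)
  ultimately show ?thesis unfolding nice_def by (intro conjI) (measurable, blast+)
qed

text \<open>Truncation makes the signal bounded with bounded support; almost everywhere it is then a limit
  of continuous functions, by the equivalence of Borel measurability with \<open>measurable_on\<close>.\<close>

lemma nice_dense:
  assumes u: "u \<in> L2" and \<delta>: "0 < \<delta>"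
  obtains v where "nice v" "l2_norm (\<lambda>t. u t - v t) < \<delta>"
proof -
  have [measurable]: "u \<in> borel_measurable borel" by (rule L2_measurable[OF u])
  define un where "un n = (\<lambda>t. indicator {- real n..real n} t * clamp (real n) (u t))" for n
  have un_m [measurable]: "un n \<in> borel_measurable borel" for n unfolding un_def by measurable
  have un_le: "\<bar>un n t\<bar> \<le> \<bar>u t\<bar>" for n t
    using clamp_bounds(2)[of "real n" "u t"] by (auto simp: un_def indicator_def)
  have "(\<lambda>n. l2_norm (\<lambda>t. u t - un n t)) \<longlonglongrightarrow> 0"
  proof (rule l2_norm_tendsto_0[OF u u])
    show "AE t in lborel. (\<lambda>n. un n t) \<longlonglongrightarrow> u t"
    proof (rule AE_I2)
      fix t
      obtain N where N: "max \<bar>t\<bar> \<bar>u t\<bar> \<le> real N" using real_arch_simple by blast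
      have "un n t = u t" if "N \<le> n" for n
      proof -
        have "\<bar>t\<bar> \<le> real n" "\<bar>u t\<bar> \<le> real n" using N that by auto
        then show ?thesis by (auto simp: un_def indicator_def clamp_id)
      qed
      then show "(\<lambda>n. un n t) \<longlonglongrightarrow> u t"
        by (intro tendsto_eventually) (auto simp: eventually_sequentially)
    qed
  qed (use un_le in auto)
  then have "\<forall>\<^sub>F n in sequentially. l2_norm (\<lambda>t. u t - un n t) < \<delta> / 2"
    using \<delta> by (intro order_tendstoD) auto
  then obtain n where n: "l2_norm (\<lambda>t. u t - un n t) < \<delta> / 2"
    by (auto simp: eventually_sequentially)
  have unL: "un n \<in> L2" using un_le[of n] by (intro L2_dominated[OF u, of _ 1]) auto
  have "un n measurable_on UNIV"
    by (rule lebesgue_measurable_imp_measurable_on_real) (simp_all add: measurable_completion)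
  then obtain N g where N: "negligible N" and g: "\<And>k. continuous_on UNIV (g k)"
    and lim: "\<And>t. t \<notin> N \<Longrightarrow> (\<lambda>k. g k t) \<longlonglongrightarrow> un n t"
    unfolding measurable_on_def by auto
  \<comment> \<open>Repeating window and saturation on the continuous approximants makes them nice
    and dominated. The limit is unaffected, because \<open>un n\<close> is fixed by both
    operations.\<close>
  define v where "v k = (\<lambda>t. indicator {- real n..real n} t * clamp (real n) (g k t))" for k
  have v: "nice (v k)" for k unfolding v_def by (rule nice_window[OF g]) simp
  have "(\<lambda>k. l2_norm (\<lambda>t. un n t - v k t)) \<longlonglongrightarrow> 0"
  proof (rule l2_norm_tendsto_0[OF unL])
    show "(\<lambda>t. real n * indicator {- real n..real n} t) \<in> L2"
      by (intro L2_scale indicator_window_L2)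
    show "AE t in lborel. \<bar>v k t\<bar> \<le> \<bar>real n * indicator {- real n..real n} t\<bar>" for k
      using clamp_bounds(1)[of "real n" "g k t" for t] by (intro AE_I2) (simp add: v_def indicator_def)
    have "AE t in lebesgue. t \<notin> N"
      using N unfolding negligible_iff_null_sets by (rule AE_not_in)
    then have "AE t in lborel. t \<notin> N" by (simp add: AE_completion_iff)
    then show "AE t in lborel. (\<lambda>k. v k t) \<longlonglongrightarrow> un n t"
    proof eventually_elim
      case (elim t)
      have "(\<lambda>k. v k t) \<longlonglongrightarrow> indicator {- real n..real n} t * clamp (real n) (un n t)"
        unfolding v_def by (intro tendsto_mult tendsto_const clamp_tendsto lim elim)
      moreover have "clamp (real n) (un n t) = un n t"
        using clamp_bounds(1)[of "real n" "u t"] by (intro clamp_id) (simp add: un_def indicator_def)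
      moreover have "indicator {- real n..real n} t * un n t = un n t"
        by (simp add: un_def indicator_def)
      ultimately show ?case by simp
    qed
  qed (use v nice_measurable in auto)
  then have "\<forall>\<^sub>F k in sequentially. l2_norm (\<lambda>t. un n t - v k t) < \<delta> / 2"
    using \<delta> by (intro order_tendstoD) auto
  then obtain k where k: "l2_norm (\<lambda>t. un n t - v k t) < \<delta> / 2"
    by (auto simp: eventually_sequentially)
  have "l2_norm (\<lambda>t. u t - v k t) = l2_norm (\<lambda>t. (u t - un n t) + (un n t - v k t))" by simp
  also have "\<dots> \<le> l2_norm (\<lambda>t. u t - un n t) + l2_norm (\<lambda>t. un n t - v k t)"
    by (intro l2_norm_add_le L2_diff u unL nice_L2 v)
  finally show thesis using that[OF v[of k]] n k by linarith
qed

section \<open>Extension of the frequency condition to all of \<open>L2\<close>\<close>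

lemma l2_norm_multiplier:
  assumes h: "h \<in> HH" and u: "u \<in> L2"
  shows "l2_norm (multiplier h u) \<le> (1 + H_norm h) * l2_norm u"
  using l2_norm_diff_le[OF u conv_op_L2[OF h u]] l2_norm_conv[OF h u]
  unfolding multiplier_def by (simp add: distrib_right)

lemma multiplier_diff:
  assumes "h \<in> HH" "u \<in> L2" "v \<in> L2"
  shows "ae_eq (multiplier h (\<lambda>t. u t - v t)) (\<lambda>t. multiplier h u t - multiplier h v t)"
  using conv_op_diff[OF assms] unfolding ae_eq_def multiplier_def by eventually_elim simp

lemma ip_multiplier_adjoint:
  assumes "h \<in> HH" "u \<in> L2" "y \<in> L2"
  shows "ip (multiplier h u) y = ip u (multiplier (reflect h) y)"
proof -
  have "ip u (multiplier (reflect h) y) = ip u y - ip u (conv_op (reflect h) y)"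
    unfolding multiplier_def by (intro ip_diff_right conv_op_L2 reflect_HH assms)
  then show ?thesis using ip_multiplier[OF assms] ip_conv_adjoint[OF assms] by simp
qed

lemma linear_operator_diff:
  assumes "linear_operator G" "u \<in> L2e" "v \<in> L2e"
  shows "ae_eq (G (\<lambda>t. u t - v t)) (\<lambda>t. G u t - G v t)"
  using assms(1)[unfolded linear_operator_def, rule_format, OF assms(2,3), of 1 "-1"] by simp

text \<open>Both sides are continuous in the norm of \<open>L2\<close>, so the inequality passes
  from the dense class of nice signals.\<close>

lemma frequency_positive:
  assumes h: "h \<in> HH" and lin: "linear_operator G" and stab: "stable_operator G"
    and G: "frequency_response G Ghat"
    and pos: "\<And>\<omega>. \<epsilon> \<le> Re (multiplier_freq h \<omega> * Ghat \<omega>)" and \<epsilon>: "0 < \<epsilon>" and u: "u \<in> L2"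
  shows "\<epsilon> * (l2_norm u)\<^sup>2 \<le> ip (multiplier h (G u)) u"
proof -
  obtain C where C: "0 \<le> C" and GL: "\<And>u. u \<in> L2 \<Longrightarrow> G u \<in> L2"
    and GC: "\<And>u. u \<in> L2 \<Longrightarrow> l2_norm (G u) \<le> C * l2_norm u"
    using stab unfolding stable_operator_def by blast
  define c where "c = (1 + H_norm h) * C"
  have c: "0 \<le> c" using H_norm_nonneg[OF h] C by (simp add: c_def)
  let ?A = "\<lambda>u. multiplier h (G u)"
  have AL: "?A u \<in> L2" if "u \<in> L2" for u by (intro multiplier_L2 h GL that)
  have Ac: "l2_norm (?A u) \<le> c * l2_norm u" if "u \<in> L2" for u
  proof -
    have "l2_norm (?A u) \<le> (1 + H_norm h) * l2_norm (G u)" by (intro l2_norm_multiplier h GL that)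
    also have "\<dots> \<le> (1 + H_norm h) * (C * l2_norm u)"
      using GC[OF that] H_norm_nonneg[OF h] by (intro mult_left_mono) auto
    finally show ?thesis by (simp add: c_def)
  qed
  have Ad: "l2_norm (\<lambda>t. ?A u t - ?A v t) \<le> c * l2_norm (\<lambda>t. u t - v t)" if uv: "u \<in> L2" "v \<in> L2" for u v
  proof -
    note Gd = L2_diff[OF GL[OF uv(1)] GL[OF uv(2)]]
    have "l2_norm (\<lambda>t. ?A u t - ?A v t) = l2_norm (multiplier h (\<lambda>t. G u t - G v t))"
      using multiplier_diff[OF h GL[OF uv(1)] GL[OF uv(2)]]
      by (intro l2_norm_cong_AE[symmetric] L2_measurable L2_diff AL uv multiplier_L2 h Gd)
    also have "\<dots> \<le> (1 + H_norm h) * l2_norm (\<lambda>t. G u t - G v t)" by (rule l2_norm_multiplier[OF h Gd])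
    also have "l2_norm (\<lambda>t. G u t - G v t) = l2_norm (G (\<lambda>t. u t - v t))"
      using linear_operator_diff[OF lin L2_subset_L2e L2_subset_L2e, OF uv]
      by (intro l2_norm_cong_AE[symmetric] L2_measurable GL L2_diff uv)
    also have "(1 + H_norm h) * l2_norm (G (\<lambda>t. u t - v t)) \<le> (1 + H_norm h) * (C * l2_norm (\<lambda>t. u t - v t))"
      using H_norm_nonneg[OF h] by (intro mult_left_mono GC L2_diff uv) simp
    finally show ?thesis by (simp add: c_def)
  qed
  \<comment> \<open>For \<open>v\<close> within \<open>d \<le> 1\<close> of \<open>u\<close>, the
    first summand bounds the change of the squared norm and the second that of the quadratic form,
    both per unit of \<open>d\<close>.\<close>
  define K where "K = \<epsilon> * (2 * l2_norm u + 3) + c * (2 * l2_norm u + 1)"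
  have K: "0 < K" unfolding K_def
  proof (rule add_pos_nonneg)
    have "0 < 2 * l2_norm u + 3" using l2_norm_nonneg[of u] by linarith
    then show "0 < \<epsilon> * (2 * l2_norm u + 3)" using \<epsilon> by (rule mult_pos_pos[rotated])
  qed (use c in simp)
  show ?thesis
  proof (rule field_le_epsilon)
    fix e :: real assume e: "0 < e"
    define d where "d = min 1 (e / K)"
    have d: "0 < d" "d \<le> 1" "d * K \<le> e" using e K by (auto simp: d_def min_def field_simps)
    obtain v where v: "nice v" and uv: "l2_norm (\<lambda>t. u t - v t) < d" using nice_dense[OF u d(1)] .
    have vL: "v \<in> L2" by (rule nice_L2[OF v])
    have vu: "l2_norm (\<lambda>t. v t - u t) \<le> d" using uv unfolding l2_norm_minus_commute[of v u] by simp
    have nv: "l2_norm v \<le> l2_norm u + d"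
      using l2_norm_add_le[OF u L2_diff[OF vL u]] vu by simp
    have nu: "l2_norm u \<le> l2_norm v + d"
      using l2_norm_add_le[OF vL L2_diff[OF u vL]] uv by simp
    have "(l2_norm u)\<^sup>2 \<le> (l2_norm v + d)\<^sup>2" using nu by (rule power_mono) simp
    also have "\<dots> = (l2_norm v)\<^sup>2 + d * (2 * l2_norm v + d)" by (simp add: power2_eq_square algebra_simps)
    also have "\<dots> \<le> (l2_norm v)\<^sup>2 + d * (2 * l2_norm u + 3)"
      using nv d by (intro add_left_mono mult_left_mono) auto
    finally have 1: "\<epsilon> * (l2_norm u)\<^sup>2 \<le> \<epsilon> * (l2_norm v)\<^sup>2 + \<epsilon> * (d * (2 * l2_norm u + 3))"
      using \<epsilon> by (simp flip: distrib_left)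
    have 2: "\<epsilon> * (l2_norm v)\<^sup>2 \<le> ip (?A v) v"
      by (rule frequency_positive_nice[OF h G GL[OF vL] v pos])
    have "ip (?A v) v - ip (?A u) u = ip (\<lambda>t. ?A v t - ?A u t) v + ip (?A u) (\<lambda>t. v t - u t)"
      using AL[OF u] AL[OF vL] u vL by (simp add: ip_diff_left ip_diff_right)
    also have "ip (\<lambda>t. ?A v t - ?A u t) v \<le> l2_norm (\<lambda>t. ?A v t - ?A u t) * l2_norm v"
      using ip_le_norm[OF L2_diff[OF AL[OF vL] AL[OF u]] vL] by linarith
    also have "\<dots> \<le> (c * d) * (l2_norm u + 1)"
      using order_trans[OF Ad[OF vL u] mult_left_mono[OF vu c]] nv d c
      by (intro mult_mono) auto
    also have "ip (?A u) (\<lambda>t. v t - u t) \<le> l2_norm (?A u) * l2_norm (\<lambda>t. v t - u t)"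
      using ip_le_norm[OF AL[OF u] L2_diff[OF vL u]] by linarith
    also have "\<dots> \<le> (c * l2_norm u) * d"
      using Ac[OF u] vu c by (intro mult_mono) auto
    finally have "ip (?A v) v \<le> ip (?A u) u + c * (d * (2 * l2_norm u + 1))"
      by (simp add: algebra_simps)
    then have "\<epsilon> * (l2_norm u)\<^sup>2 \<le> ip (?A u) u + d * K"
      using 1 2 by (simp add: K_def algebra_simps)
    then show "\<epsilon> * (l2_norm u)\<^sup>2 \<le> ip (?A u) u + e" using d by linarith
  qed
qed

section \<open>Stability\<close>

text \<open>The Neumann iterates of the Toeplitz equation \<open>tail T (multiplier h a) = 0\<close>, with \<open>a\<close>
  prescribed up to time \<open>T\<close>. Approximate solutions suffice, so completeness of \<open>L2\<close> is avoided.\<close>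

lemma multiplier_extension:
  assumes h: "h \<in> HH" and q: "H_norm h < 1" and f: "f \<in> L2"
  obtains K where "0 \<le> K" "\<And>\<eta>. 0 < \<eta> \<Longrightarrow> \<exists>a\<in>L2. trunc T a = trunc T f \<and> l2_norm a \<le> K \<and>
    l2_norm (tail T (multiplier h a)) \<le> \<eta>"
proof -
  let ?q = "H_norm h"
  have q0: "0 \<le> ?q" by (rule H_norm_nonneg[OF h])
  define a where "a = rec_nat (trunc T f) (\<lambda>_ x t. trunc T f t + tail T (conv_op h x) t)"
  have a0: "a 0 = trunc T f" and aS: "a (Suc n) = (\<lambda>t. trunc T f t + tail T (conv_op h (a n)) t)" for n
    by (simp_all add: a_def)
  have f0: "trunc T f \<in> L2" by (rule L2_trunc[OF f])
  have aL: "a n \<in> L2" for n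
    by (induction n) (auto simp: a0 aS f0 intro!: L2_add L2_tail conv_op_L2 h)
  have at: "trunc T (a n) = trunc T f" for n
    by (cases n) (auto simp: a0 aS trunc_def tail_def)
  \<comment> \<open>The fixed point of \<open>K = l2_norm f + H_norm h * K\<close>, hence a bound on
    all iterates that does not depend on \<eta>.\<close>
  define K where "K = l2_norm f / (1 - ?q)"
  have K0: "0 \<le> K" using q by (simp add: K_def)
  have K: "K = l2_norm f + ?q * K" using q by (simp add: K_def field_simps)
  have aK: "l2_norm (a n) \<le> K" for n
  proof (induction n)
    case 0
    have "0 \<le> ?q * K" using q0 K0 by simp
    then show ?case using l2_norm_trunc[OF f, of T] K by (simp add: a0)
  next
    case (Suc n)
    have "l2_norm (a (Suc n)) \<le> l2_norm (trunc T f) + l2_norm (tail T (conv_op h (a n)))"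
      unfolding aS by (intro l2_norm_add_le f0 L2_tail conv_op_L2 h aL)
    also have "l2_norm (tail T (conv_op h (a n))) \<le> ?q * l2_norm (a n)"
      by (rule order_trans[OF l2_norm_tail[OF conv_op_L2[OF h aL]] l2_norm_conv[OF h aL]])
    also have "\<dots> \<le> ?q * K" using Suc q0 by (rule mult_left_mono)
    finally show ?case using l2_norm_trunc[OF f, of T] K by linarith
  qed
  define e where "e n = l2_norm (\<lambda>t. a (Suc n) t - a n t)" for n
  have e_Suc: "e (Suc n) \<le> ?q * e n" for n
  proof -
    note d = L2_diff[OF aL[of "Suc n"] aL[of n]]
    note cd = conv_op_diff[OF h aL[of "Suc n"] aL[of n]]
    let ?c = "\<lambda>t. conv_op h (a (Suc n)) t - conv_op h (a n) t"
    have cL: "?c \<in> L2" by (intro L2_diff conv_op_L2 h aL)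
    have "(\<lambda>t. a (Suc (Suc n)) t - a (Suc n) t) = tail T ?c"
      unfolding aS[of "Suc n"] aS[of n, THEN fun_cong] by (auto simp: tail_def aS)
    then have "e (Suc n) = l2_norm (tail T ?c)" by (simp add: e_def)
    also have "\<dots> \<le> l2_norm ?c" by (rule l2_norm_tail[OF cL])
    also have "\<dots> = l2_norm (conv_op h (\<lambda>t. a (Suc n) t - a n t))"
      by (intro l2_norm_cong_AE[OF cd, symmetric] L2_measurable conv_op_L2 h d cL)
    also have "\<dots> \<le> ?q * e n" unfolding e_def by (rule l2_norm_conv[OF h d])
    finally show ?thesis .
  qed
  have e_le: "e n \<le> ?q ^ n * e 0" for n
  proof (induction n)
    case (Suc n)
    then show ?case using order_trans[OF e_Suc mult_left_mono[OF Suc q0]] by (simp add: mult.assoc)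
  qed simp
  \<comment> \<open>After \<open>T\<close> the next iterate equals \<open>conv_op h (a n)\<close>,
    so the residual there is, up to sign, the difference of successive iterates.\<close>
  have tail_le: "l2_norm (tail T (multiplier h (a n))) \<le> e n" for n
    unfolding e_def
  proof (rule l2_norm_mono)
    show "(\<lambda>t. a (Suc n) t - a n t) \<in> L2" by (intro L2_diff aL)
    show "tail T (multiplier h (a n)) \<in> borel_measurable borel"
      by (intro L2_measurable L2_tail multiplier_L2 h aL)
    show "AE t in lborel. \<bar>tail T (multiplier h (a n)) t\<bar> \<le> \<bar>a (Suc n) t - a n t\<bar>"
      by (intro AE_I2) (auto simp: aS tail_def trunc_def multiplier_def)
  qed
  show thesis
  proof (rule that[OF K0])
    fix \<eta> :: real assume "0 < \<eta>"
    have "(\<lambda>n. ?q ^ n * e 0) \<longlonglongrightarrow> 0 * e 0"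
      using q q0 by (intro tendsto_mult LIMSEQ_realpow_zero tendsto_const)
    then have "\<forall>\<^sub>F n in sequentially. ?q ^ n * e 0 < \<eta>"
      using \<open>0 < \<eta>\<close> by (intro order_tendstoD) auto
    then obtain n where "?q ^ n * e 0 < \<eta>" by (auto simp: eventually_sequentially)
    then have "l2_norm (tail T (multiplier h (a n))) \<le> \<eta>"
      using tail_le[of n] e_le[of n] by linarith
    then show "\<exists>a\<in>L2. trunc T a = trunc T f \<and> l2_norm a \<le> K \<and>
        l2_norm (tail T (multiplier h a)) \<le> \<eta>"
      using aL at aK by blast
  qed
qed

text \<open>Fatou's lemma along the truncation times \<open>T = n\<close>.\<close>

lemma L2_of_bounded_truncations:
  assumes "x \<in> L2e" and bound: "\<And>T. l2_norm (trunc T x) \<le> R"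
  shows "x \<in> L2"
proof (rule L2I)
  show [measurable]: "x \<in> borel_measurable borel" by (rule L2e_measurable[OF assms(1)])
  have lim: "(\<lambda>n. ennreal ((trunc (real n) x t)\<^sup>2)) \<longlonglongrightarrow> ennreal ((x t)\<^sup>2)" for t
  proof (rule tendsto_eventually)
    obtain N where "t \<le> real N" using real_arch_simple by blast
    then show "\<forall>\<^sub>F n in sequentially. ennreal ((trunc (real n) x t)\<^sup>2) = ennreal ((x t)\<^sup>2)"
      unfolding eventually_sequentially trunc_def by (intro exI[of _ N]) auto
  qed
  have "(\<integral>\<^sup>+t. ennreal ((trunc T x t)\<^sup>2) \<partial>lborel) \<le> ennreal (R\<^sup>2)" for T
  proof -
    have "trunc T x \<in> L2" using assms(1) by (simp add: L2e_def)
    then have "(\<integral>\<^sup>+t. ennreal ((trunc T x t)\<^sup>2) \<partial>lborel) = ennreal ((l2_norm (trunc T x))\<^sup>2)"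
      unfolding l2_norm_square by (intro nn_integral_eq_integral L2_square) simp_all
    also have "\<dots> \<le> ennreal (R\<^sup>2)" using bound by (intro ennreal_leI power_mono) auto
    finally show ?thesis .
  qed
  then have "limsup (\<lambda>n. \<integral>\<^sup>+t. ennreal ((trunc (real n) x t)\<^sup>2) \<partial>lborel) \<le> ennreal (R\<^sup>2)"
    by (intro Limsup_bounded always_eventually) auto
  have "(\<integral>\<^sup>+t. ennreal ((x t)\<^sup>2) \<partial>lborel) = (\<integral>\<^sup>+t. liminf (\<lambda>n. ennreal ((trunc (real n) x t)\<^sup>2)) \<partial>lborel)"
    by (intro nn_integral_cong) (simp add: lim_imp_Liminf[OF _ lim])
  also have "\<dots> \<le> liminf (\<lambda>n. \<integral>\<^sup>+t. ennreal ((trunc (real n) x t)\<^sup>2) \<partial>lborel)"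
    by (rule nn_integral_liminf) measurable
  also have "\<dots> \<le> limsup (\<lambda>n. \<integral>\<^sup>+t. ennreal ((trunc (real n) x t)\<^sup>2) \<partial>lborel)"
    by (rule Liminf_le_Limsup) simp
  also note \<open>limsup _ \<le> _\<close>
  finally show "integrable lborel (\<lambda>t. (x t)\<^sup>2)"
    unfolding integrable_iff_bounded by (auto simp: le_less_trans)
qed

text \<open>The bound does not involve \<open>T\<close>, as \<open>L2_of_bounded_truncations\<close>
  requires. The noncausal multiplier acts only on square-integrable continuations; causality is
  asked of \<open>G\<close> alone.\<close>

lemma loop_bound:
  assumes h: "h \<in> HH" and q: "H_norm h < 1" and hB: "B * H_norm h \<le> 1" and B: "1 \<le> B"
    and mono: "mono \<beta>" and odd: "odd_fun \<beta>" and bdd: "\<And>x. \<bar>\<beta> x\<bar> \<le> C * \<bar>x\<bar>"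
    and GL: "\<And>u. u \<in> L2 \<Longrightarrow> G u \<in> L2" and GC: "\<And>u. u \<in> L2 \<Longrightarrow> l2_norm (G u) \<le> D * l2_norm u" and D: "0 \<le> D"
    and causal: "causal G"
    and pos: "\<And>u. u \<in> L2 \<Longrightarrow> \<epsilon> * (l2_norm u)\<^sup>2 \<le> ip (multiplier h (G u)) u" and \<epsilon>: "0 < \<epsilon>"
    and u: "u \<in> L2e" and y: "y \<in> L2e" and sec: "sector \<beta> B u y" and g: "g \<in> L2"
    and loop: "ae_eq (trunc T u) (trunc T (\<lambda>t. g t - G (trunc T y) t))"
  shows "l2_norm (trunc T y) \<le> l2_norm (multiplier h g) / \<epsilon>"
proof -
  let ?h' = "reflect h"
  have h': "?h' \<in> HH" "H_norm ?h' < 1" using q by (simp_all add: reflect_HH h reflect_norm)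
  have uT: "trunc T u \<in> L2" and yT: "trunc T y \<in> L2" using u y by (simp_all add: L2e_def)
  have tt: "trunc T (trunc T x) = trunc T x" for x by (auto simp: trunc_def)
  obtain Ka where Ka: "0 \<le> Ka" and ext_a: "\<And>\<eta>. 0 < \<eta> \<Longrightarrow> \<exists>a\<in>L2. trunc T a = trunc T u \<and>
      l2_norm a \<le> Ka \<and> l2_norm (tail T (multiplier h a)) \<le> \<eta>"
    using multiplier_extension[OF h q uT, of T] unfolding tt by blast
  obtain Kb where Kb: "0 \<le> Kb" and ext_b: "\<And>\<eta>. 0 < \<eta> \<Longrightarrow> \<exists>b\<in>L2. trunc T b = trunc T y \<and>
      l2_norm b \<le> Kb \<and> l2_norm (tail T (multiplier ?h' b)) \<le> \<eta>"
    using multiplier_extension[OF h' yT, of T] unfolding tt by blast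
  have "\<bar>\<beta> 1\<bar> \<le> C * \<bar>1\<bar>" by (rule bdd)
  then have C: "0 \<le> C" by simp
  have b0: "\<beta> 0 = 0" using bdd[of 0] by simp
  define R where "R = l2_norm (multiplier h g)"
  \<comment> \<open>Collects the norms paired with residuals of size \<eta>: those of
    \<open>b\<close>, \<open>z\<close>, \<open>a\<close> and \<open>g - G b\<close>, in this
    order.\<close>
  define K where "K = Kb + B * C * Ka + Ka + (l2_norm g + D * Kb)"
  have K0: "0 \<le> K" using Ka Kb B C D by (simp add: K_def)
  \<comment> \<open>Here \<open>n\<close> is the norm of the continuation \<open>b\<close>, which
    changes with \<eta>; hence the existential form.\<close>
  have main: "\<exists>n. l2_norm (trunc T y) \<le> n \<and> \<epsilon> * n\<^sup>2 \<le> R * n + \<eta> * K" if \<eta>: "0 < \<eta>" for \<eta>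
  proof -
    obtain a where aL: "a \<in> L2" and a: "trunc T a = trunc T u" "l2_norm a \<le> Ka"
      "l2_norm (tail T (multiplier h a)) \<le> \<eta>" using ext_a[OF \<eta>] by blast
    obtain b where bL: "b \<in> L2" and b: "trunc T b = trunc T y" "l2_norm b \<le> Kb"
      "l2_norm (tail T (multiplier ?h' b)) \<le> \<eta>" using ext_b[OF \<eta>] by blast
    let ?Ma = "multiplier h a" and ?Mb = "multiplier ?h' b"
    have MaL: "?Ma \<in> L2" and MbL: "?Mb \<in> L2" by (intro multiplier_L2 h h' aL bL)+
    have [measurable]: "a \<in> borel_measurable borel" "y \<in> borel_measurable borel" "\<beta> \<in> borel_measurable borel"
      using aL y mono by (auto intro: L2_measurable L2e_measurable borel_measurable_mono)
    \<comment> \<open>An admissible output for the continued input \<open>a\<close>. It agrees with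
      \<open>b\<close> up to \<open>T\<close>, and the later discrepancy meets only the small tail
      of \<open>multiplier h a\<close>.\<close>
    define z where "z t = (if t \<le> T then y t else \<beta> (a t))" for t
    have [measurable]: "z \<in> borel_measurable borel" unfolding z_def by measurable
    have sz: "sector \<beta> B a z" unfolding z_def by (rule sector_extend[OF sec odd mono B a(1)])
    have dom: "AE t in lborel. \<bar>z t\<bar> \<le> (B * C) * \<bar>a t\<bar>"
      using B by (intro sector_dominated[OF sz _ bdd]) simp
    have zL: "z \<in> L2" by (rule L2_dominated[OF aL _ dom]) measurable
    have "l2_norm z \<le> l2_norm (\<lambda>t. (B * C) * a t)"
      using dom B C by (intro l2_norm_mono L2_scale aL) (auto simp: abs_mult)
    also have "\<dots> = (B * C) * l2_norm a" using B C by (simp add: l2_norm_scale)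
    also have "\<dots> \<le> (B * C) * Ka" using a(2) B C by (intro mult_left_mono) auto
    finally have zn: "l2_norm z \<le> B * C * Ka" .
    have small: "\<bar>ip (tail T x) w\<bar> \<le> \<eta> * k"
      if "x \<in> L2" "w \<in> L2" "l2_norm (tail T x) \<le> \<eta>" "l2_norm w \<le> k" for x w k
      using order_trans[OF ip_le_norm[OF L2_tail[OF that(1)] that(2)]
          mult_mono[OF that(3,4) less_imp_le[OF \<eta>] l2_norm_nonneg]] .
    have zb: "trunc T z = trunc T b" using b(1) by (auto simp: z_def trunc_def fun_eq_iff)
    have "0 \<le> ip ?Ma z"
      using B by (intro multiplier_positive[OF h hB _ mono b0 bdd aL zL sz]) simp
    also have "\<dots> = ip (trunc T ?Ma) z + ip (tail T ?Ma) z" by (rule ip_split[OF MaL zL])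
    also have "ip (trunc T ?Ma) z = ip (trunc T ?Ma) b" unfolding ip_trunc zb ..
    also have "\<dots> = ip ?Ma b - ip (tail T ?Ma) b" using ip_split[OF MaL bL, of T] by simp
    finally have "0 \<le> ip ?Ma b + \<eta> * Kb + \<eta> * (B * C * Ka)"
      using small[OF MaL zL a(3) zn] small[OF MaL bL a(3) b(2)] by linarith
    moreover have "ip ?Ma b = ip a ?Mb" by (rule ip_multiplier_adjoint[OF h aL bL])
    moreover have "ip a ?Mb = ip (trunc T u) ?Mb + ip (tail T ?Mb) a"
      using ip_split[OF aL MbL, of T] unfolding a(1) ip_tail[of T a] ip_commute[of "tail T ?Mb"] .
    moreover have "ip (tail T ?Mb) a \<le> \<eta> * Ka" using small[OF MbL aL b(3) a(2)] by linarith
    \<comment> \<open>By causality \<open>G b\<close> up to \<open>T\<close> depends only on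
      \<open>b\<close> up to \<open>T\<close>, where it equals \<open>y\<close>; so the loop
      equation survives the continuation.\<close>
    moreover have "ip (trunc T u) ?Mb = ip (trunc T (\<lambda>t. g t - G b t)) ?Mb"
    proof (rule ip_cong_AE)
      have "ae_eq (trunc T (G b)) (trunc T (G (trunc T b)))"
        using causal L2_subset_L2e[OF bL] by (simp add: causal_def)
      then show "ae_eq (trunc T u) (trunc T (\<lambda>t. g t - G b t))"
        using loop unfolding ae_eq_def b(1) by eventually_elim (simp add: trunc_def split: if_splits)
    qed (auto simp: ae_eq_def intro!: L2_measurable uT MbL L2_trunc L2_diff g GL bL)
    moreover have "ip (trunc T (\<lambda>t. g t - G b t)) ?Mb =
        ip (\<lambda>t. g t - G b t) ?Mb - ip (tail T ?Mb) (\<lambda>t. g t - G b t)"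
      using ip_split[OF L2_diff[OF g GL[OF bL]] MbL, of T]
      unfolding ip_tail[of T "\<lambda>t. g t - G b t"] ip_commute[of "tail T ?Mb"] by simp
    moreover have "l2_norm (\<lambda>t. g t - G b t) \<le> l2_norm g + D * Kb"
      using l2_norm_diff_le[OF g GL[OF bL]] GC[OF bL] mult_left_mono[OF b(2) D] by linarith
    then have "- ip (tail T ?Mb) (\<lambda>t. g t - G b t) \<le> \<eta> * (l2_norm g + D * Kb)"
      using small[OF MbL L2_diff[OF g GL[OF bL]] b(3)] by fastforce
    moreover have "ip (\<lambda>t. g t - G b t) ?Mb = ip (multiplier h g) b - ip (multiplier h (G b)) b"
      using ip_diff_left[OF g GL[OF bL] MbL] by (simp add: ip_multiplier_adjoint h g GL bL)
    moreover have "ip (multiplier h g) b \<le> R * l2_norm b"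
      using ip_le_norm[OF multiplier_L2[OF h g] bL] by (simp add: R_def)
    moreover have "\<epsilon> * (l2_norm b)\<^sup>2 \<le> ip (multiplier h (G b)) b" by (rule pos[OF bL])
    ultimately have "\<epsilon> * (l2_norm b)\<^sup>2 \<le> R * l2_norm b + \<eta> * K"
      unfolding K_def by (simp add: distrib_left)
    moreover have "l2_norm (trunc T y) \<le> l2_norm b" using l2_norm_trunc[OF bL, of T] b(1) by simp
    ultimately show ?thesis by blast
  qed
  show ?thesis
  proof (rule ccontr)
    let ?y = "l2_norm (trunc T y)"
    assume "\<not> ?thesis"
    then have yR: "0 < \<epsilon> * ?y - R" using \<epsilon> by (simp add: R_def field_simps)
    have y0: "0 < ?y"
    proof -
      have "0 \<le> R" by (simp add: R_def)
      then have "0 < \<epsilon> * ?y" using yR by linarith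
      then show ?thesis using \<epsilon> by (simp add: zero_less_mult_iff)
    qed
    \<comment> \<open>The gap that a violated bound would leave. With
      \<open>\<eta> = p / (K + 1)\<close> the error is below \<open>p\<close>, while
      \<open>n \<ge> ?y\<close> makes the gap at \<open>n\<close> at least \<open>p\<close>; adding
      1 allows \<open>K = 0\<close>.\<close>
    define p where "p = ?y * (\<epsilon> * ?y - R)"
    have p: "0 < p" using yR y0 by (simp add: p_def)
    have "p / (K + 1) > 0" using p K0 by simp
    from main[OF this] obtain n where n: "?y \<le> n" "\<epsilon> * n\<^sup>2 \<le> R * n + p / (K + 1) * K" by blast
    have "p \<le> n * (\<epsilon> * n - R)"
      unfolding p_def using n(1) \<epsilon> y0 yR by (intro mult_mono) auto
    also have "\<dots> \<le> p / (K + 1) * K" using n(2) by (simp add: power2_eq_square algebra_simps)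
    also have "\<dots> < p" using p K0 by (simp add: field_simps)
    finally show False by simp
  qed
qed

theorem corollary2:
  fixes G \<phi> :: "signal \<Rightarrow> signal"
    and \<alpha>lo \<alpha>hi \<beta>lo \<beta>hi :: "real \<Rightarrow> real"
    and B :: real
    and h :: gfun
  assumes G_op: "L2e_operator G"
    and G_lin: "linear_operator G"
    and G_ti: "time_invariant G"
    and G_causal: "causal G"
    and G_stable: "stable_operator G"
    and phi_op: "L2e_operator \<phi>"
    and wp: "lurye_well_posed G \<phi>"
    and phi_zero: "\<forall>u\<in>L2e. AE t in lborel. u t = 0 \<longrightarrow> \<phi> u t = 0"
    and alpha_bounds: "nonlinearity_bounded \<phi> \<alpha>lo \<alpha>hi"
    and alpha_mono: "mono \<alpha>lo" "mono \<alpha>hi"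
    and alpha_bdd: "bounded_fun \<alpha>lo" "bounded_fun \<alpha>hi"
    and alpha_nonneg: "\<forall>x. x \<noteq> 0 \<longrightarrow> \<alpha>lo x / x \<ge> 0"
    and beta_bounds: "nonlinearity_bounded \<phi> \<beta>lo \<beta>hi"
    and beta_mono: "mono \<beta>lo" "mono \<beta>hi"
    and beta_bdd: "bounded_fun \<beta>lo" "bounded_fun \<beta>hi"
    and beta_odd: "odd_fun \<beta>lo" "odd_fun \<beta>hi"
    and beta_nonneg: "\<forall>x. x \<noteq> 0 \<longrightarrow> \<beta>lo x / x \<ge> 0"
    and B_ge: "B \<ge> 1"
    and alpha_B: "bounded_above_by \<alpha>hi (\<lambda>x. B * \<alpha>lo x)"
    and beta_B: "bounded_above_by \<beta>hi (\<lambda>x. B * \<beta>lo x)"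
    and h_HH: "h \<in> HH"
    and h_norm: "B * H_norm h < 1"
  shows "(\<forall>u\<in>L2. integrable lborel (\<lambda>t. multiplier h u t * \<phi> u t) \<and>
                 0 \<le> (LINT t|lborel. multiplier h u t * \<phi> u t)) \<and>
         (\<forall>Ghat. frequency_response G Ghat \<longrightarrow>
            (\<exists>\<epsilon>>0. \<forall>\<omega>. Re (multiplier_freq h \<omega> * Ghat \<omega>) \<ge> \<epsilon>) \<longrightarrow>
            lurye_stable G \<phi>)"
proof -
  obtain C where bdd: "\<And>x. \<bar>\<beta>lo x\<bar> \<le> C * \<bar>x\<bar>"
    using beta_bdd(1) unfolding bounded_fun_def by blast
  have b0: "\<beta>lo 0 = 0" using bdd[of 0] by simp
  have B0: "0 \<le> B" using B_ge by simp
  have hB: "B * H_norm h \<le> 1" using h_norm by simp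
  have sec: "sector \<beta>lo B u (\<phi> u)" if "u \<in> L2e" for u
    by (rule nonlinearity_sector[OF beta_bounds phi_zero beta_nonneg beta_odd(1) beta_B that])
  have "integrable lborel (\<lambda>t. multiplier h u t * \<phi> u t) \<and>
      0 \<le> (LINT t|lborel. multiplier h u t * \<phi> u t)" if u: "u \<in> L2" for u
  proof -
    have ue: "u \<in> L2e" by (rule L2_subset_L2e[OF u])
    have "\<phi> u \<in> L2e" using phi_op ue by (simp add: L2e_operator_def)
    then have y: "\<phi> u \<in> L2"
      using sector_dominated[OF sec[OF ue] B0 bdd] by (intro L2_dominated[OF u]) (rule L2e_measurable)
    show ?thesis
      using L2_integrable_mult[OF multiplier_L2[OF h_HH u] y]
        multiplier_positive[OF h_HH hB B0 beta_mono(1) b0 bdd u y sec[OF ue]]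
      by (simp add: ip_def)
  qed
  moreover have "lurye_stable G \<phi>"
    if Ghat: "frequency_response G Ghat"
      and "\<exists>\<epsilon>>0. \<forall>\<omega>. Re (multiplier_freq h \<omega> * Ghat \<omega>) \<ge> \<epsilon>" for Ghat
  proof -
    obtain \<epsilon> where \<epsilon>: "0 < \<epsilon>" and pos: "\<And>\<omega>. \<epsilon> \<le> Re (multiplier_freq h \<omega> * Ghat \<omega>)"
      using \<open>\<exists>\<epsilon>>0. _\<close> by blast
    obtain D where D: "0 \<le> D" and GL: "\<And>u. u \<in> L2 \<Longrightarrow> G u \<in> L2"
      and GC: "\<And>u. u \<in> L2 \<Longrightarrow> l2_norm (G u) \<le> D * l2_norm u"
      using G_stable unfolding stable_operator_def by blast
    \<comment> \<open>From \<open>B \<ge> 1\<close>; this contraction drives the Neumann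
      iteration.\<close>
    have q: "H_norm h < 1"
      using mult_right_mono[OF B_ge H_norm_nonneg[OF h_HH]] h_norm by simp
    show ?thesis unfolding lurye_stable_def
    proof (intro ballI allI impI)
      fix r1 r2 u1 u2 y1 y2
      assume r1: "r1 \<in> L2" and r2: "r2 \<in> L2" and "lurye G \<phi> r1 r2 u1 u2 y1 y2"
      then have L: "u1 \<in> L2e" "u2 \<in> L2e" "y1 \<in> L2e" "y2 \<in> L2e"
        and eq: "ae_eq y1 (G u1)" "ae_eq y2 (\<phi> u2)" "ae_eq u1 (\<lambda>t. r1 t - y2 t)" "ae_eq u2 (\<lambda>t. y1 t + r2 t)"
        by (simp_all add: lurye_def)
      note m = L[THEN L2e_measurable]
      have sec2: "sector \<beta>lo B u2 y2"
        using sec[OF L(2)] eq(2) unfolding sector_def ae_eq_def by eventually_elim simp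
      \<comment> \<open>Eliminating \<open>u1\<close> and \<open>y1\<close> reduces the loop to
        \<open>u2 = g - G y2\<close>, with external input \<open>g\<close>.\<close>
      define g where "g = (\<lambda>t. r2 t + G r1 t)"
      have g: "g \<in> L2" unfolding g_def by (intro L2_add r2 GL r1)
      have r1e: "r1 \<in> L2e" by (rule L2_subset_L2e[OF r1])
      have G1: "ae_eq (G u1) (G (\<lambda>t. r1 t - y2 t))"
        using G_op L(1) L2e_diff[OF r1e L(4)] eq(3) unfolding L2e_operator_def by blast
      have G2: "ae_eq (G (\<lambda>t. r1 t - y2 t)) (\<lambda>t. G r1 t - G y2 t)"
        by (rule linear_operator_diff[OF G_lin r1e L(4)])
      have "l2_norm (trunc T y2) \<le> l2_norm (multiplier h g) / \<epsilon>" for T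
      proof (rule loop_bound[OF h_HH q hB B_ge beta_mono(1) beta_odd(1) bdd GL GC D G_causal
            frequency_positive[OF h_HH G_lin G_stable Ghat pos \<epsilon>] \<epsilon> L(2,4) sec2 g])
        have G3: "ae_eq (trunc T (G y2)) (trunc T (G (trunc T y2)))"
          using G_causal L(4) by (simp add: causal_def)
        show "ae_eq (trunc T u2) (trunc T (\<lambda>t. g t - G (trunc T y2) t))"
          using eq(1,4) G1 G2 G3 unfolding ae_eq_def
          by eventually_elim (simp add: trunc_def g_def split: if_splits)
      qed
      \<comment> \<open>Once \<open>y2\<close> is square-integrable, the loop equations give
        \<open>u1\<close>, \<open>y1\<close> and \<open>u2\<close> in turn.\<close>
      then have y2: "y2 \<in> L2" by (rule L2_of_bounded_truncations[OF L(4)])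
      have u1: "u1 \<in> L2"
        using eq(3) by (intro L2_cong_AE[OF L2_diff[OF r1 y2] m(1)]) (auto simp: ae_eq_def)
      have y1: "y1 \<in> L2"
        using eq(1) by (intro L2_cong_AE[OF GL[OF u1] m(3)]) (auto simp: ae_eq_def)
      have u2: "u2 \<in> L2"
        using eq(4) by (intro L2_cong_AE[OF L2_add[OF y1 r2] m(2)]) (auto simp: ae_eq_def)
      show "u1 \<in> L2 \<and> u2 \<in> L2 \<and> y1 \<in> L2 \<and> y2 \<in> L2" using u1 u2 y1 y2 by simp
    qed
  qed
  ultimately show ?thesis by blast
qed

end
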